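(* Let $N$ be a Seifert manifold with Seifert invariants $\{e;(\epsilon,g);(a_1,b_1),\ldots,(a_n,b_n)\}$, let $\pi_1(N)$ be given by the associated presentation with generators $s_1,\ldots,s_n,v_1,\ldots,v_{g'},h$, and let $\varphi:\pi_1(N)\to\mathbb{Z}_2=\mathbb{Z}/2\mathbb{Z}$ be an epimorphism with $\varphi(h)=1$. Then $\ker(\varphi)$ is (isomorphic to) the fundamental group of the Seifert manifold given by the invariants $$\Big\{\frac{e-m}{2}-m';\ (\epsilon,g);\ (a_1,b'_1),\ldots,(a_n,b'_n)\Big\},$$ where $b'_k=\frac{b_k}{2}$ if $b_k$ is even and $b'_k=\frac{a_k+b_k}{2}$ if $b_k$ is odd, $m$ is the number of indices $k$ for which $b_k$ is odd, and $m'$ is an integer such that $$\begin{cases} m'=0 & \text{if } \epsilon=o_1 \text{ or } n_2,\\ m'\equiv\sum_{j=1}^{g'}\varphi(v_j)\pmod 2 & \text{if } \epsilon=o_2 \text{ or } n_1,\\ m'\equiv\varphi(v_1)\pmod 2 & \text{if } \epsilon=n_3,\\ m'\equiv\varphi(v_1)+\varphi(v_2)\pmod 2 & \text{if } \epsilon=n_4.\end{cases}$$ (In the cases $\epsilon=o_2,n_1,n_3,n_4$, $m'$ is only determined modulo $2$, which is sufficient to determine the Seifert manifold.)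
   Context: Seifert manifolds (orientable or not) are described by a list of Seifert invariants $\{e;(\epsilon,g);(a_1,b_1),\ldots,(a_n,b_n)\}$, not assumed normalized: $e$ is an integer, $g$ is the genus of the base surface, and for each $k$ the integers $a_k,b_k$ are coprime with $a_k\neq0$. The type $\epsilon$ is one of $o_1,o_2,n_1,n_2,n_3,n_4$ and determines signs $\varepsilon_1,\ldots,\varepsilon_{g'}\in\{1,-1\}$: - $o_1$: base orientable, total space orientable; all $\varepsilon_j=1$; - $o_2$: base orientable, total space non-orientable, $g\ge1$; all $\varepsilon_j=-1$; - $n_1$: base and total space non-orientable, $g\ge1$; all $\varepsilon_j=1$; - $n_2$: base non-orientable, total space orientable, $g\ge1$; all $\varepsilon_j=-1$; - $n_3$: base and total space non-orientable, $g\ge2$; $\varepsilon_1=1$ and all other $\varepsilon_j=-1$; - $n_4$: base and total space non-orientable, $g\ge3$; $\varepsilon_1=\varepsilon_2=1$ and all other $\varepsilon_j=-1$. If the base is orientable ($\epsilon=o_1,o_2$), $g'=2g$ and $V=[v_1,v_2]\cdots[v_{2g-1},v_{2g}]$, where $[x,y]=xyx^{-1}y^{-1}$. If the base is non-orientable ($\epsilon=n_1,\ldots,n_4$), $g'=g$ and $V=v_1^2\cdots v_g^2$. The fundamental group of the Seifert manifold with these invariants is the group with generators $s_1,\ldots,s_n,v_1,\ldots,v_{g'},h$ and relators $$[s_k,h],\quad s_k^{a_k}h^{b_k}\ (1\le k\le n);\qquad v_jhv_j^{-1}h^{-\varepsilon_j}\ (1\le j\le g');\qquad h^{-e}s_1\cdots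 s_nV.$$ *)

theory Defs
  imports "HOL-Algebra.Elementary_Groups" "HOL-Number_Theory.Cong"
begin

section \<open>Groups given by generators and relators\<close>

text \<open>The letter \<open>(x, True)\<close> stands for the generator \<open>x\<close> and \<open>(x, False)\<close> for its inverse.\<close>

type_synonym 'g word = "('g \<times> bool) list"

definition words :: "'g set \<Rightarrow> 'g word set" where
  "words X = lists (X \<times> UNIV)"

definition word_inv :: "'g word \<Rightarrow> 'g word" where
  "word_inv w = rev (map (\<lambda>(x, s). (x, \<not> s)) w)"

definition word_pow :: "'g word \<Rightarrow> int \<Rightarrow> 'g word" where
  "word_pow w k =
     (if 0 \<le> k then concat (replicate (nat k) w) else concat (replicate (nat (- k)) (word_inv w)))"

definition word_comm :: "'g word \<Rightarrow> 'g word \<Rightarrow> 'g word" where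
  "word_comm u w = u @ w @ word_inv u @ word_inv w"

text \<open>The smallest congruence on the free monoid of words over \<open>X\<close> that makes letters inverse to
  each other and trivializes the relators.\<close>

inductive_set pres_rel :: "'g set \<Rightarrow> 'g word set \<Rightarrow> ('g word \<times> 'g word) set"
  for X :: "'g set" and R :: "'g word set"
where
  cancel: "x \<in> X \<Longrightarrow> ([(x, s), (x, \<not> s)], []) \<in> pres_rel X R"
| relator: "r \<in> R \<Longrightarrow> r \<in> words X \<Longrightarrow> (r, []) \<in> pres_rel X R"
| refl: "w \<in> words X \<Longrightarrow> (w, w) \<in> pres_rel X R"
| sym: "(u, w) \<in> pres_rel X R \<Longrightarrow> (w, u) \<in> pres_rel X R"
| trans: "(u, w) \<in> pres_rel X R \<Longrightarrow> (w, z) \<in> pres_rel X R \<Longrightarrow> (u, z) \<in> pres_rel X R"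
| append: "(u, u') \<in> pres_rel X R \<Longrightarrow> (w, w') \<in> pres_rel X R \<Longrightarrow> (u @ w, u' @ w') \<in> pres_rel X R"

definition presented_group :: "'g set \<Rightarrow> 'g word set \<Rightarrow> 'g word set monoid" where
  "presented_group X R =
     \<lparr>carrier = words X // pres_rel X R,
      monoid.mult = (\<lambda>A B. \<Union>u\<in>A. \<Union>w\<in>B. pres_rel X R `` {u @ w}),
      one = pres_rel X R `` {[]}\<rparr>"

definition pres_gen :: "'g set \<Rightarrow> 'g word set \<Rightarrow> 'g \<Rightarrow> 'g word set" where
  "pres_gen X R x = pres_rel X R `` {[(x, True)]}"

lemma words_append [simp]: "u @ w \<in> words X \<longleftrightarrow> u \<in> words X \<and> w \<in> words X"
  by (auto simp: words_def)

lemma words_Nil [simp]: "[] \<in> words X"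
  by (simp add: words_def)

lemma words_Cons [simp]: "p # w \<in> words X \<longleftrightarrow> fst p \<in> X \<and> w \<in> words X"
  by (cases p) (auto simp: words_def)

lemma word_inv_Nil [simp]: "word_inv [] = []"
  by (simp add: word_inv_def)

lemma word_inv_Cons: "word_inv (p # w) = word_inv w @ [(fst p, \<not> snd p)]"
  by (cases p) (simp add: word_inv_def)

lemma word_inv_in_words [simp]: "w \<in> words X \<Longrightarrow> word_inv w \<in> words X"
  by (induction w) (auto simp: word_inv_Cons)

lemma pres_rel_words: "(u, w) \<in> pres_rel X R \<Longrightarrow> u \<in> words X \<and> w \<in> words X"
  by (induction rule: pres_rel.induct) auto

lemma equiv_pres_rel: "equiv (words X) (pres_rel X R)"
proof (rule equivI)
  show "pres_rel X R \<subseteq> words X \<times> words X"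
    by (auto dest: pres_rel_words)
  show "refl_on (words X) (pres_rel X R)"
    by (auto simp: refl_on_def intro: pres_rel.refl)
  show "Relation.sym (pres_rel X R)"
    by (auto intro!: symI intro: pres_rel.sym)
  show "Relation.trans (pres_rel X R)"
    by (auto intro!: transI intro: pres_rel.trans)
qed

lemma pres_class_eq_iff:
  "u \<in> words X \<Longrightarrow> w \<in> words X \<Longrightarrow>
    pres_rel X R `` {u} = pres_rel X R `` {w} \<longleftrightarrow> (u, w) \<in> pres_rel X R"
  by (rule eq_equiv_class_iff [OF equiv_pres_rel])

lemma carrier_presented_group: "carrier (presented_group X R) = words X // pres_rel X R"
  by (simp add: presented_group_def)

lemma one_presented_group: "\<one>\<^bsub>presented_group X R\<^esub> = pres_rel X R `` {[]}"
  by (simp add: presented_group_def)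

lemma pres_mult_class:
  assumes u: "u \<in> words X" and w: "w \<in> words X"
  shows "pres_rel X R `` {u} \<otimes>\<^bsub>presented_group X R\<^esub> pres_rel X R `` {w} = pres_rel X R `` {u @ w}"
proof -
  have eq: "pres_rel X R `` {u' @ w'} = pres_rel X R `` {u @ w}"
    if u': "u' \<in> pres_rel X R `` {u}" and w': "w' \<in> pres_rel X R `` {w}" for u' w'
  proof -
    have "(u @ w, u' @ w') \<in> pres_rel X R"
      using u' w' by (intro pres_rel.append) simp_all
    then show ?thesis
      by (rule equiv_class_eq [OF equiv_pres_rel, symmetric])
  qed
  have ne: "u \<in> pres_rel X R `` {u}" "w \<in> pres_rel X R `` {w}"
    using u w by (auto intro: pres_rel.refl)
  have "(\<Union>u'\<in>pres_rel X R `` {u}. \<Union>w'\<in>pres_rel X R `` {w}. pres_rel X R `` {u' @ w'}) =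
        (\<Union>u'\<in>pres_rel X R `` {u}. \<Union>w'\<in>pres_rel X R `` {w}. pres_rel X R `` {u @ w})"
    by (intro SUP_cong HOL.refl eq)
  also have "\<dots> = pres_rel X R `` {u @ w}"
    using ne by blast
  finally show ?thesis
    by (simp add: presented_group_def)
qed

lemma pres_class_closed: "w \<in> words X \<Longrightarrow> pres_rel X R `` {w} \<in> carrier (presented_group X R)"
  by (simp add: carrier_presented_group quotientI)

lemma pres_carrierE:
  assumes "A \<in> carrier (presented_group X R)"
  obtains w where "w \<in> words X" "A = pres_rel X R `` {w}"
  using assms unfolding carrier_presented_group by (rule quotientE)

lemma pres_rel_inv_left: "w \<in> words X \<Longrightarrow> (word_inv w @ w, []) \<in> pres_rel X R"
proof (induction w)
  case Nil
  then show ?case by (simp add: pres_rel.refl)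
next
  case (Cons p w)
  obtain x s where p: "p = (x, s)" by (cases p)
  have w: "w \<in> words X" and x: "x \<in> X" using Cons.prems p by auto
  have 1: "([(x, \<not> s), (x, s)], []) \<in> pres_rel X R"
    using pres_rel.cancel [OF x, of "\<not> s"] by simp
  have "(word_inv w @ ([(x, \<not> s), (x, s)] @ w), word_inv w @ ([] @ w)) \<in> pres_rel X R"
    by (intro pres_rel.append 1 pres_rel.refl word_inv_in_words w)
  then show ?case
    using Cons.IH [OF w] p by (auto simp: word_inv_Cons intro: pres_rel.trans)
qed

theorem group_presented_group: "group (presented_group X R)"
proof (rule groupI, goal_cases)
  case (1 A B)
  from 1(1) obtain u where u: "u \<in> words X" "A = pres_rel X R `` {u}" by (rule pres_carrierE)
  from 1(2) obtain w where w: "w \<in> words X" "B = pres_rel X R `` {w}" by (rule pres_carrierE)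
  show ?case
    unfolding u(2) w(2) pres_mult_class [OF u(1) w(1)] using u(1) w(1) by (intro pres_class_closed) simp
next
  case 2
  show ?case unfolding one_presented_group by (intro pres_class_closed) simp
next
  case (3 A B C)
  from 3(1) obtain u where u: "u \<in> words X" "A = pres_rel X R `` {u}" by (rule pres_carrierE)
  from 3(2) obtain w where w: "w \<in> words X" "B = pres_rel X R `` {w}" by (rule pres_carrierE)
  from 3(3) obtain z where z: "z \<in> words X" "C = pres_rel X R `` {z}" by (rule pres_carrierE)
  show ?case
    unfolding u(2) w(2) z(2) using u(1) w(1) z(1) by (simp add: pres_mult_class)
next
  case (4 A)
  then obtain u where u: "u \<in> words X" "A = pres_rel X R `` {u}" by (rule pres_carrierE)
  show ?case
    unfolding u(2) one_presented_group using u(1) by (simp add: pres_mult_class)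
next
  case (5 A)
  then obtain w where w: "w \<in> words X" "A = pres_rel X R `` {w}" by (rule pres_carrierE)
  have "pres_rel X R `` {word_inv w} \<otimes>\<^bsub>presented_group X R\<^esub> A = pres_rel X R `` {word_inv w @ w}"
    unfolding w(2) using w(1) by (simp add: pres_mult_class)
  also have "\<dots> = \<one>\<^bsub>presented_group X R\<^esub>"
    unfolding one_presented_group using pres_rel_inv_left [OF w(1)]
    by (rule equiv_class_eq [OF equiv_pres_rel])
  finally show ?case
    using pres_class_closed [OF word_inv_in_words [OF w(1)]] by blast
qed

fun word_eval :: "('a, 'm) monoid_scheme \<Rightarrow> ('g \<Rightarrow> 'a) \<Rightarrow> 'g word \<Rightarrow> 'a" where
  "word_eval K f [] = \<one>\<^bsub>K\<^esub>"
| "word_eval K f ((x, s) # w) = (if s then f x else inv\<^bsub>K\<^esub> f x) \<otimes>\<^bsub>K\<^esub> word_eval K f w"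

lemma word_eval_closed:
  assumes "group K" "f ` X \<subseteq> carrier K" "w \<in> words X"
  shows "word_eval K f w \<in> carrier K"
proof -
  interpret group K by fact
  show ?thesis using assms(3,2) by (induction w) (auto simp: image_subset_iff)
qed

lemma word_eval_append:
  assumes "group K" "f ` X \<subseteq> carrier K" "u \<in> words X" "w \<in> words X"
  shows "word_eval K f (u @ w) = word_eval K f u \<otimes>\<^bsub>K\<^esub> word_eval K f w"
proof -
  interpret group K by fact
  have w: "word_eval K f w \<in> carrier K" by (rule word_eval_closed) fact+
  show ?thesis using assms(3)
  proof (induction u)
    case Nil
    then show ?case using w by simp
  next
    case (Cons p u)
    obtain x s where p: "p = (x, s)" by (cases p)
    have x: "f x \<in> carrier K" using Cons.prems p assms(2) by auto
    have "word_eval K f u \<in> carrier K"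
      using Cons.prems by (intro word_eval_closed [OF assms(1,2)]) simp
    then show ?case using Cons p w x by (simp add: m_assoc)
  qed
qed

text \<open>The universal property of a presentation; the homomorphism is determined on the carrier
  because \<open>pres_gen X R ` X\<close> generates the group.\<close>

theorem presented_group_universal:
  assumes K: "group K" and f: "f ` X \<subseteq> carrier K"
    and R: "\<And>r. r \<in> R \<Longrightarrow> r \<in> words X \<Longrightarrow> word_eval K f r = \<one>\<^bsub>K\<^esub>"
  obtains \<psi> where "\<psi> \<in> hom (presented_group X R) K"
    "\<And>w. w \<in> words X \<Longrightarrow> \<psi> (pres_rel X R `` {w}) = word_eval K f w"
    "\<And>x. x \<in> X \<Longrightarrow> \<psi> (pres_gen X R x) = f x"
proof
  interpret group K by fact
  have inv: "word_eval K f u = word_eval K f w" if "(u, w) \<in> pres_rel X R" for u w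
    using that
  proof induction
    case (cancel x s)
    then have "f x \<in> carrier K" using f by auto
    then show ?case by simp
  next
    case (append u u' w w')
    then show ?case
      using pres_rel_words [OF append(1)] pres_rel_words [OF append(2)]
      by (simp add: word_eval_append [OF K f])
  qed (use R in simp_all)
  define \<psi> where "\<psi> A = word_eval K f (SOME w. w \<in> A)" for A
  show cls: "\<psi> (pres_rel X R `` {w}) = word_eval K f w" if "w \<in> words X" for w
  proof -
    have "w \<in> pres_rel X R `` {w}" using that by (simp add: pres_rel.refl)
    then have "(SOME w'. w' \<in> pres_rel X R `` {w}) \<in> pres_rel X R `` {w}" by (rule someI)
    then show ?thesis unfolding \<psi>_def by (intro inv [symmetric]) simp
  qed
  show "\<psi> (pres_gen X R x) = f x" if "x \<in> X" for x
  proof -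
    have "f x \<in> carrier K" using f that by auto
    then show ?thesis using that cls [of "[(x, True)]"] by (simp add: pres_gen_def)
  qed
  show "\<psi> \<in> hom (presented_group X R) K"
  proof (rule homI)
    fix A assume "A \<in> carrier (presented_group X R)"
    then obtain u where u: "u \<in> words X" "A = pres_rel X R `` {u}" by (rule pres_carrierE)
    show "\<psi> A \<in> carrier K" unfolding u(2) cls [OF u(1)] by (rule word_eval_closed [OF K f u(1)])
    fix B assume "B \<in> carrier (presented_group X R)"
    then obtain w where w: "w \<in> words X" "B = pres_rel X R `` {w}" by (rule pres_carrierE)
    have "u @ w \<in> words X" using u(1) w(1) by simp
    then show "\<psi> (A \<otimes>\<^bsub>presented_group X R\<^esub> B) = \<psi> A \<otimes>\<^bsub>K\<^esub> \<psi> B"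
      unfolding u(2) w(2) pres_mult_class [OF u(1) w(1)]
      by (simp only: cls u(1) w(1) word_eval_append [OF K f])
  qed
qed

section \<open>Seifert invariants\<close>

datatype seifert_type = O1 | O2 | N1 | N2 | N3 | N4

fun orientable_base :: "seifert_type \<Rightarrow> bool" where
  "orientable_base O1 = True"
| "orientable_base O2 = True"
| "orientable_base _ = False"

fun min_genus :: "seifert_type \<Rightarrow> nat" where
  "min_genus O1 = 0"
| "min_genus O2 = 1"
| "min_genus N1 = 1"
| "min_genus N2 = 1"
| "min_genus N3 = 2"
| "min_genus N4 = 3"

fun seifert_sign :: "seifert_type \<Rightarrow> nat \<Rightarrow> int" where
  "seifert_sign O1 j = 1"
| "seifert_sign O2 j = - 1"
| "seifert_sign N1 j = 1"
| "seifert_sign N2 j = - 1"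
| "seifert_sign N3 j = (if j = 1 then 1 else - 1)"
| "seifert_sign N4 j = (if j = 1 \<or> j = 2 then 1 else - 1)"

text \<open>The invariants \<open>{e; (\<epsilon>, g); (a 1, b 1), \<dots>, (a n, b n)}\<close> are passed as
  \<open>e \<epsilon> g n a b\<close>; only the values of \<open>a\<close> and \<open>b\<close> on \<open>{1..n}\<close> matter.  Any integer \<open>e\<close> is
  allowed, so \<open>e\<close> does not occur in the admissibility condition.\<close>

definition seifert_invariants ::
  "seifert_type \<Rightarrow> nat \<Rightarrow> nat \<Rightarrow> (nat \<Rightarrow> int) \<Rightarrow> (nat \<Rightarrow> int) \<Rightarrow> bool" where
  "seifert_invariants \<epsilon> g n a b \<longleftrightarrow>
     min_genus \<epsilon> \<le> g \<and> (\<forall>k\<in>{1..n}. a k \<noteq> 0 \<and> coprime (a k) (b k))"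

section \<open>Fundamental groups of Seifert manifolds\<close>

datatype seifert_gen = Sgen nat | Vgen nat | Hgen

definition num_v :: "seifert_type \<Rightarrow> nat \<Rightarrow> nat" where
  "num_v \<epsilon> g = (if orientable_base \<epsilon> then 2 * g else g)"

definition seifert_gens :: "seifert_type \<Rightarrow> nat \<Rightarrow> nat \<Rightarrow> seifert_gen set" where
  "seifert_gens \<epsilon> g n = Sgen ` {1..n} \<union> Vgen ` {1..num_v \<epsilon> g} \<union> {Hgen}"

abbreviation letter :: "'g \<Rightarrow> 'g word" where
  "letter x \<equiv> [(x, True)]"

definition surface_word :: "seifert_type \<Rightarrow> nat \<Rightarrow> seifert_gen word" where
  "surface_word \<epsilon> g =
     (if orientable_base \<epsilon>
      then concat (map (\<lambda>i. word_comm (letter (Vgen (2 * i - 1))) (letter (Vgen (2 * i)))) [1..<Suc g])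
      else concat (map (\<lambda>j. word_pow (letter (Vgen j)) 2) [1..<Suc g]))"

definition seifert_rels ::
  "int \<Rightarrow> seifert_type \<Rightarrow> nat \<Rightarrow> nat \<Rightarrow> (nat \<Rightarrow> int) \<Rightarrow> (nat \<Rightarrow> int) \<Rightarrow> seifert_gen word set" where
  "seifert_rels e \<epsilon> g n a b =
     {word_comm (letter (Sgen k)) (letter Hgen) | k. k \<in> {1..n}} \<union>
     {word_pow (letter (Sgen k)) (a k) @ word_pow (letter Hgen) (b k) | k. k \<in> {1..n}} \<union>
     {letter (Vgen j) @ letter Hgen @ word_inv (letter (Vgen j)) @
        word_pow (letter Hgen) (- seifert_sign \<epsilon> j) | j. j \<in> {1..num_v \<epsilon> g}} \<union>
     {word_pow (letter Hgen) (- e) @ concat (map (\<lambda>k. letter (Sgen k)) [1..<Suc n]) @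
        surface_word \<epsilon> g}"

definition seifert_group ::
  "int \<Rightarrow> seifert_type \<Rightarrow> nat \<Rightarrow> nat \<Rightarrow> (nat \<Rightarrow> int) \<Rightarrow> (nat \<Rightarrow> int) \<Rightarrow> seifert_gen word set monoid" where
  "seifert_group e \<epsilon> g n a b = presented_group (seifert_gens \<epsilon> g n) (seifert_rels e \<epsilon> g n a b)"

text \<open>The element of the fundamental group represented by a generator of the presentation.\<close>

definition seifert_elem ::
  "int \<Rightarrow> seifert_type \<Rightarrow> nat \<Rightarrow> nat \<Rightarrow> (nat \<Rightarrow> int) \<Rightarrow> (nat \<Rightarrow> int) \<Rightarrow> seifert_gen \<Rightarrow>
     seifert_gen word set" where
  "seifert_elem e \<epsilon> g n a b x = pres_gen (seifert_gens \<epsilon> g n) (seifert_rels e \<epsilon> g n a b) x"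

end

theory Submission
  imports Defs
begin

text \<open>Let \<open>\<phi>\<close> be the given epimorphism from \<open>G\<close> to \<open>\<int>\<^sub>2\<close>, and choose integers \<open>d k\<close> and \<open>p j\<close> with the
  parities of \<open>\<phi> (s k)\<close> and \<open>\<phi> (v j)\<close>.  The elements \<open>s k h^(- d k)\<close> and \<open>v j h^(- p j)\<close> lie in the kernel and,
  together with \<open>h\<close>, still generate \<open>G\<close>.  Conjugation by any generator sends \<open>h\<close> to \<open>h\<close> or to its
  inverse, so in each relator all the powers of \<open>h\<close> can be collected at one end.  The new generators
  therefore satisfy relators of the same form, in which \<open>b k\<close> has become \<open>b k + d k a k\<close> and \<open>e\<close> has
  become \<open>e - \<Sum> d k - 2 \<Sum> c j p j\<close>
  (\<open>seifert_tuple_shift\<close>).  Here \<open>c j\<close> is a coefficient in \<open>{0, 1, -1}\<close> that records how the powers of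
  \<open>h\<close> accumulate in the surface word: in a commutator they cancel if both letters commute with \<open>h\<close>, and
  add up with opposite signs if both invert it; in a square they cancel exactly if the letter inverts
  \<open>h\<close>.

  With \<open>d k = 1\<close> for odd \<open>b k\<close> and \<open>d k = 0\<close> otherwise, and with \<open>p\<close> chosen such that
  \<open>\<Sum> c j p j = m'\<close>, the new invariants are \<open>2 e'\<close> and \<open>2 b' k\<close>, where \<open>e' = (e - m) / 2 - m'\<close>.  Such a
  \<open>p\<close> exists because the parities of the \<open>p j\<close> fix \<open>\<Sum> c j p j\<close> only modulo 2: unless all \<open>c j\<close> vanish,
  \<open>c 1\<close> is \<open>1\<close> or \<open>-1\<close> and \<open>p 1\<close> may be changed by any even number (\<open>surface_lift_exists\<close>).  This is the
  reason why \<open>m'\<close> is free up to even integers.  Now \<open>h\<close> enters the long relator and those of the exceptional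
  fibres only through its square, and the remaining relators pass from \<open>h\<close> to its square
  (\<open>seifert_tuple_square_fibre\<close>).  So the new generators and \<open>h\<^sup>2\<close> define a homomorphism \<open>\<psi>\<close> to the
  kernel from the group \<open>A\<close> that is presented with \<open>e'\<close> and \<open>b'\<close>.

  To see that \<open>\<psi>\<close> is an isomorphism onto the kernel, the step from \<open>h\<close> to its square is undone
  abstractly.  Conjugation by a square root of the fibre \<open>H\<close> of \<open>A\<close> would have to fix the
  \<open>S k\<close> and send \<open>V j\<close> to itself or to \<open>V j H^(-1)\<close>; by \<open>seifert_tuple_shift\<close> once more this rule is
  an endomorphism \<open>\<alpha>\<close> of \<open>A\<close>, and its square is conjugation by \<open>H\<close> (\<open>fibre_root_automorphism\<close>).  Hence
  \<open>A\<close> has index two in a group \<open>E\<close> in which \<open>H\<close> has a root (\<open>group_root_extension\<close>).  Reading the change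
  of generators backwards, \<open>E\<close> satisfies the relators of \<open>G\<close>.  This gives a homomorphism \<open>\<Phi>\<close> from \<open>G\<close>
  to \<open>E\<close> that is inverse to the extension of \<open>\<psi>\<close> to \<open>E\<close>, and it identifies the kernel of \<open>\<phi>\<close> with
  \<open>A\<close> (\<open>seifert_kernel_iso\<close>).\<close>

section \<open>Evaluating words in a group\<close>

lemma concat_in_words [simp]: "concat ws \<in> words X \<longleftrightarrow> (\<forall>w\<in>set ws. w \<in> words X)"
  by (induction ws) auto

lemma word_pow_in_words [simp]: "w \<in> words X \<Longrightarrow> word_pow w k \<in> words X"
  by (simp add: word_pow_def)

lemma word_comm_in_words [simp]: "u \<in> words X \<Longrightarrow> w \<in> words X \<Longrightarrow> word_comm u w \<in> words X"
  by (simp add: word_comm_def)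

lemma words_mono: "w \<in> words X \<Longrightarrow> X \<subseteq> Y \<Longrightarrow> w \<in> words Y"
  by (auto simp: words_def)

lemma word_eval_cong:
  "w \<in> words X \<Longrightarrow> (\<And>x. x \<in> X \<Longrightarrow> f x = f' x) \<Longrightarrow> word_eval K f w = word_eval K f' w"
  by (induction w) auto

lemma word_eval_hom:
  assumes K: "group K" and L: "group L" and q: "q \<in> hom K L" and f: "f ` X \<subseteq> carrier K"
    and w: "w \<in> words X"
  shows "q (word_eval K f w) = word_eval L (q \<circ> f) w"
proof -
  interpret group_hom K L q using K L q by (simp add: group_hom_def group_hom_axioms_def)
  show ?thesis using w
  proof (induction w)
    case (Cons p w)
    obtain x s where p: "p = (x, s)" by (cases p)
    have "f x \<in> carrier K" "word_eval K f w \<in> carrier K"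
      using Cons.prems p f word_eval_closed [OF K f, of w] by auto
    then show ?case using Cons p by simp
  qed simp
qed

lemma word_eval_trivial:
  assumes K: "group K" and w: "w \<in> words X" and f: "\<And>x. x \<in> X \<Longrightarrow> f x = \<one>\<^bsub>K\<^esub>"
  shows "word_eval K f w = \<one>\<^bsub>K\<^esub>"
proof -
  interpret group K by fact
  show ?thesis using w f by (induction w) auto
qed

context group
begin

lemma word_eval_inv:
  assumes f: "f ` X \<subseteq> carrier G" and w: "w \<in> words X"
  shows "word_eval G f (word_inv w) = inv (word_eval G f w)"
  using w
proof (induction w)
  case (Cons p w)
  obtain x s where p: "p = (x, s)" by (cases p)
  have x: "x \<in> X" "f x \<in> carrier G" and w: "w \<in> words X" "word_eval G f w \<in> carrier G"
    using Cons.prems p f word_eval_closed [OF is_group f, of w] by auto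
  have "word_eval G f (word_inv (p # w)) = inv (word_eval G f w) \<otimes> word_eval G f [(x, \<not> s)]"
    using Cons.IH x w p by (simp add: word_inv_Cons word_eval_append [OF is_group f])
  then show ?case using x w p by (auto simp: inv_mult_group)
qed simp

lemma word_eval_pow:
  assumes f: "f ` X \<subseteq> carrier G" and w: "w \<in> words X"
  shows "word_eval G f (word_pow w k) = word_eval G f w [^] k"
proof -
  have rep: "word_eval G f (concat (replicate i u)) = word_eval G f u [^] i"
    if u: "u \<in> words X" for i :: nat and u
  proof (induction i)
    case (Suc i)
    have "concat (replicate i u) \<in> words X" using u by simp
    then have "word_eval G f (concat (replicate (Suc i) u)) = word_eval G f u \<otimes> word_eval G f u [^] i"
      by (simp add: word_eval_append [OF is_group f u] Suc)
    then show ?case by (simp only: nat_pow_Suc2 [OF word_eval_closed [OF is_group f u]])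
  qed simp
  have c: "word_eval G f w \<in> carrier G" by (rule word_eval_closed [OF is_group f w])
  show ?thesis
  proof (cases "0 \<le> k")
    case True
    then show ?thesis by (subst int_pow_def2) (simp add: word_pow_def rep [OF w])
  next
    case False
    then have "word_eval G f (word_pow w k) = inv (word_eval G f w) [^] nat (- k)"
      by (simp add: word_pow_def rep [OF word_inv_in_words [OF w]] word_eval_inv [OF f w])
    then show ?thesis
      using False by (subst int_pow_def2) (simp only: nat_pow_inv [OF c] if_True not_le)
  qed
qed

lemma word_eval_comm:
  assumes f: "f ` X \<subseteq> carrier G" and u: "u \<in> words X" and w: "w \<in> words X"
  shows "word_eval G f (word_comm u w) =
    word_eval G f u \<otimes> (word_eval G f w \<otimes> (inv (word_eval G f u) \<otimes> inv (word_eval G f w)))"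
  using u w by (simp add: word_comm_def word_eval_append [OF is_group f] word_eval_inv [OF f])

end

section \<open>Homomorphisms out of a presented group\<close>

text \<open>Every class of words is the value of a word at the generators.  This turns each statement about
  the elements of a presented group into one about word evaluation.\<close>

lemma word_eval_pres_gen:
  assumes "w \<in> words X"
  shows "word_eval (presented_group X R) (pres_gen X R) w = pres_rel X R `` {w}"
  using assms
proof (induction w)
  case (Cons p w)
  interpret group "presented_group X R" by (rule group_presented_group)
  obtain x s where p: "p = (x, s)" by (cases p)
  have x: "x \<in> X" and w: "w \<in> words X" using Cons.prems p by auto
  have c: "pres_gen X R x \<in> carrier (presented_group X R)"
    using x by (simp add: pres_gen_def pres_class_closed)
  have "pres_rel X R `` {[(x, False)]} \<otimes>\<^bsub>presented_group X R\<^esub> pres_gen X R x = 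
      pres_rel X R `` {[(x, False), (x, True)]}"
    using x by (simp add: pres_gen_def pres_mult_class)
  also have "\<dots> = \<one>\<^bsub>presented_group X R\<^esub>"
    using pres_rel.cancel [OF x, of False] x by (simp add: one_presented_group pres_class_eq_iff)
  finally have "inv\<^bsub>presented_group X R\<^esub> (pres_gen X R x) = pres_rel X R `` {[(x, False)]}"
    using x c by (intro inv_equality) (auto simp: pres_class_closed)
  then have "(if s then pres_gen X R x else inv\<^bsub>presented_group X R\<^esub> (pres_gen X R x)) =
      pres_rel X R `` {[(x, s)]}"
    by (auto simp: pres_gen_def)
  then show ?case
    using Cons.IH p x w by (simp add: pres_mult_class)
qed (simp add: one_presented_group)

lemma pres_gen_closed: "pres_gen X R ` X \<subseteq> carrier (presented_group X R)"
  by (auto simp: pres_gen_def pres_class_closed)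

lemma presented_group_relator:
  "r \<in> R \<Longrightarrow> r \<in> words X \<Longrightarrow>
    word_eval (presented_group X R) (pres_gen X R) r = \<one>\<^bsub>presented_group X R\<^esub>"
  by (simp add: word_eval_pres_gen one_presented_group pres_class_eq_iff pres_rel.relator)

lemma presented_group_hom_eqI:
  assumes K: "group K" and p: "p \<in> hom (presented_group X R) K" and q: "q \<in> hom (presented_group X R) K"
    and eq: "\<And>x. x \<in> X \<Longrightarrow> p (pres_gen X R x) = q (pres_gen X R x)"
    and A: "A \<in> carrier (presented_group X R)"
  shows "p A = q A"
proof -
  obtain w where w: "w \<in> words X" and A: "A = word_eval (presented_group X R) (pres_gen X R) w"
    using A by (auto elim: pres_carrierE simp: word_eval_pres_gen)
  show ?thesis
    using word_eval_cong [OF w, of "p \<circ> pres_gen X R" "q \<circ> pres_gen X R"] eq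
    by (simp add: A word_eval_hom [OF group_presented_group K _ pres_gen_closed w] p q)
qed

section \<open>Seifert relations in an arbitrary group\<close>

text \<open>By the universal property, the assignments \<open>f\<close> described here correspond to the homomorphisms
  from the Seifert group to \<open>K\<close>.  Manipulations of the presentation become statements about such assignments in
  an arbitrary group, so that one calculation serves for the given group, for the target group, for its
  extension by a root and for \<open>\<int>\<^sub>2\<close>.\<close>

definition seifert_tuple ::
  "('a, 'm) monoid_scheme \<Rightarrow> int \<Rightarrow> seifert_type \<Rightarrow> nat \<Rightarrow> nat \<Rightarrow> (nat \<Rightarrow> int) \<Rightarrow> (nat \<Rightarrow> int) \<Rightarrow>
     (seifert_gen \<Rightarrow> 'a) \<Rightarrow> bool" where
  "seifert_tuple K e \<epsilon> g n a b f \<longleftrightarrow>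
     f ` seifert_gens \<epsilon> g n \<subseteq> carrier K \<and> (\<forall>r\<in>seifert_rels e \<epsilon> g n a b. word_eval K f r = \<one>\<^bsub>K\<^esub>)"

text \<open>The part of the relations in which neither \<open>e\<close> nor \<open>a\<close> nor \<open>b\<close> occurs.  It is stable under all the
  changes of generators below.\<close>

definition fibre_relations ::
  "('a, 'm) monoid_scheme \<Rightarrow> seifert_type \<Rightarrow> nat \<Rightarrow> nat \<Rightarrow> (seifert_gen \<Rightarrow> 'a) \<Rightarrow> bool" where
  "fibre_relations K \<epsilon> g n f \<longleftrightarrow>
     f ` seifert_gens \<epsilon> g n \<subseteq> carrier K \<and>
     (\<forall>k\<in>{1..n}. f (Sgen k) \<otimes>\<^bsub>K\<^esub> f Hgen = f Hgen \<otimes>\<^bsub>K\<^esub> f (Sgen k)) \<and>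
     (\<forall>j\<in>{1..num_v \<epsilon> g}.
        f (Vgen j) \<otimes>\<^bsub>K\<^esub> f Hgen = f Hgen [^]\<^bsub>K\<^esub> seifert_sign \<epsilon> j \<otimes>\<^bsub>K\<^esub> f (Vgen j))"

abbreviation exceptional_word :: "nat \<Rightarrow> seifert_gen word" where
  "exceptional_word n \<equiv> concat (map (\<lambda>k. letter (Sgen k)) [1..<Suc n])"

lemma exceptional_word_in_words: "exceptional_word n \<in> words (Sgen ` {1..n})"
  by (auto simp: words_def simp del: upt_Suc)

lemma surface_word_in_words: "surface_word \<epsilon> g \<in> words (Vgen ` {1..num_v \<epsilon> g})"
  by (auto simp: surface_word_def num_v_def simp del: upt_Suc
      intro!: word_comm_in_words word_pow_in_words imageI) presburger+

lemma seifert_gens_mem: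
  "Sgen k \<in> seifert_gens \<epsilon> g n \<longleftrightarrow> k \<in> {1..n}"
  "Vgen j \<in> seifert_gens \<epsilon> g n \<longleftrightarrow> j \<in> {1..num_v \<epsilon> g}"
  "Hgen \<in> seifert_gens \<epsilon> g n"
  by (auto simp: seifert_gens_def)

lemma exceptional_word_in_seifert_words: "exceptional_word n \<in> words (seifert_gens \<epsilon> g n)"
  by (rule words_mono [OF exceptional_word_in_words]) (auto simp: seifert_gens_def)

lemma surface_word_in_seifert_words: "surface_word \<epsilon> g \<in> words (seifert_gens \<epsilon> g n)"
  by (rule words_mono [OF surface_word_in_words]) (auto simp: seifert_gens_def)

lemma seifert_rels_in_words: "seifert_rels e \<epsilon> g n a b \<subseteq> words (seifert_gens \<epsilon> g n)"
  using exceptional_word_in_seifert_words [of n \<epsilon> g] surface_word_in_seifert_words [of \<epsilon> g n]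
  by (auto simp: seifert_rels_def seifert_gens_mem simp del: upt_Suc)

text \<open>The relators in equational form.  The exceptional and the surface part of the long relator remain
  words, since only their behaviour under a change of the assignment matters.\<close>

lemma seifert_tuple_iff:
  assumes "group K"
  shows "seifert_tuple K e \<epsilon> g n a b f \<longleftrightarrow>
    fibre_relations K \<epsilon> g n f \<and>
    (\<forall>k\<in>{1..n}. f (Sgen k) [^]\<^bsub>K\<^esub> a k \<otimes>\<^bsub>K\<^esub> f Hgen [^]\<^bsub>K\<^esub> b k = \<one>\<^bsub>K\<^esub>) \<and>
    f Hgen [^]\<^bsub>K\<^esub> (- e) \<otimes>\<^bsub>K\<^esub>
      (word_eval K f (exceptional_word n) \<otimes>\<^bsub>K\<^esub> word_eval K f (surface_word \<epsilon> g)) = \<one>\<^bsub>K\<^esub>"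
proof (cases "f ` seifert_gens \<epsilon> g n \<subseteq> carrier K")
  case False
  then show ?thesis by (simp add: seifert_tuple_def fibre_relations_def)
next
  case f: True
  interpret group K by fact
  let ?X = "seifert_gens \<epsilon> g n"
  have h: "f Hgen \<in> carrier K" and hX: "letter Hgen \<in> words ?X"
    using f by (auto simp: seifert_gens_mem image_subset_iff)
  have s: "f (Sgen k) \<in> carrier K" "letter (Sgen k) \<in> words ?X" if "k \<in> {1..n}" for k
    using f that by (auto simp: seifert_gens_mem image_subset_iff)
  have v: "f (Vgen j) \<in> carrier K" "letter (Vgen j) \<in> words ?X" if "j \<in> {1..num_v \<epsilon> g}" for j
    using f that by (auto simp: seifert_gens_mem image_subset_iff)
  note ev = word_eval_append [OF is_group f] word_eval_comm [OF f] word_eval_pow [OF f]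
    word_eval_inv [OF f]
  have 1: "word_eval K f (word_comm (letter (Sgen k)) (letter Hgen)) = \<one>\<^bsub>K\<^esub> \<longleftrightarrow>
      f (Sgen k) \<otimes>\<^bsub>K\<^esub> f Hgen = f Hgen \<otimes>\<^bsub>K\<^esub> f (Sgen k)" if k: "k \<in> {1..n}" for k
  proof -
    have "word_eval K f (word_comm (letter (Sgen k)) (letter Hgen)) =
        (f (Sgen k) \<otimes>\<^bsub>K\<^esub> f Hgen) \<otimes>\<^bsub>K\<^esub> inv\<^bsub>K\<^esub> (f Hgen \<otimes>\<^bsub>K\<^esub> f (Sgen k))"
      using s [OF k] h hX by (simp only: ev) (simp add: inv_mult_group m_assoc)
    then show ?thesis using s [OF k] h by (simp add: inv_solve_right')
  qed
  have 2: "word_eval K f (word_pow (letter (Sgen k)) (a k) @ word_pow (letter Hgen) (b k)) =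
      f (Sgen k) [^]\<^bsub>K\<^esub> a k \<otimes>\<^bsub>K\<^esub> f Hgen [^]\<^bsub>K\<^esub> b k" if k: "k \<in> {1..n}" for k
    using s [OF k] h hX by (simp only: ev word_pow_in_words) simp
  have 3: "word_eval K f (letter (Vgen j) @ letter Hgen @ word_inv (letter (Vgen j)) @
      word_pow (letter Hgen) (- seifert_sign \<epsilon> j)) = \<one>\<^bsub>K\<^esub> \<longleftrightarrow>
      f (Vgen j) \<otimes>\<^bsub>K\<^esub> f Hgen = f Hgen [^]\<^bsub>K\<^esub> seifert_sign \<epsilon> j \<otimes>\<^bsub>K\<^esub> f (Vgen j)"
    if j: "j \<in> {1..num_v \<epsilon> g}" for j
  proof -
    have "word_eval K f (letter (Vgen j) @ letter Hgen @ word_inv (letter (Vgen j)) @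
        word_pow (letter Hgen) (- seifert_sign \<epsilon> j)) =
        (f (Vgen j) \<otimes>\<^bsub>K\<^esub> f Hgen) \<otimes>\<^bsub>K\<^esub> inv\<^bsub>K\<^esub> (f Hgen [^]\<^bsub>K\<^esub> seifert_sign \<epsilon> j \<otimes>\<^bsub>K\<^esub> f (Vgen j))"
      using v [OF j] h hX
      by (simp only: ev word_pow_in_words word_inv_in_words words_append)
        (simp add: inv_mult_group m_assoc int_pow_neg)
    then show ?thesis using v [OF j] h by (simp add: inv_solve_right')
  qed
  have 4: "word_eval K f (word_pow (letter Hgen) (- e) @ exceptional_word n @ surface_word \<epsilon> g) =
      f Hgen [^]\<^bsub>K\<^esub> (- e) \<otimes>\<^bsub>K\<^esub>
        (word_eval K f (exceptional_word n) \<otimes>\<^bsub>K\<^esub> word_eval K f (surface_word \<epsilon> g))"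
    using h hX exceptional_word_in_seifert_words [of n \<epsilon> g] surface_word_in_seifert_words [of \<epsilon> g n]
    by (simp only: ev word_pow_in_words words_append) simp
  have "(\<forall>r\<in>seifert_rels e \<epsilon> g n a b. word_eval K f r = \<one>\<^bsub>K\<^esub>) \<longleftrightarrow>
      (\<forall>k\<in>{1..n}. word_eval K f (word_comm (letter (Sgen k)) (letter Hgen)) = \<one>\<^bsub>K\<^esub>) \<and>
      (\<forall>k\<in>{1..n}. word_eval K f (word_pow (letter (Sgen k)) (a k) @ word_pow (letter Hgen) (b k)) = \<one>\<^bsub>K\<^esub>) \<and>
      (\<forall>j\<in>{1..num_v \<epsilon> g}. word_eval K f (letter (Vgen j) @ letter Hgen @ word_inv (letter (Vgen j)) @
         word_pow (letter Hgen) (- seifert_sign \<epsilon> j)) = \<one>\<^bsub>K\<^esub>) \<and>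
      word_eval K f (word_pow (letter Hgen) (- e) @ exceptional_word n @ surface_word \<epsilon> g) = \<one>\<^bsub>K\<^esub>"
    unfolding seifert_rels_def by blast
  also have "\<dots> \<longleftrightarrow>
      (\<forall>k\<in>{1..n}. f (Sgen k) \<otimes>\<^bsub>K\<^esub> f Hgen = f Hgen \<otimes>\<^bsub>K\<^esub> f (Sgen k)) \<and>
      (\<forall>k\<in>{1..n}. f (Sgen k) [^]\<^bsub>K\<^esub> a k \<otimes>\<^bsub>K\<^esub> f Hgen [^]\<^bsub>K\<^esub> b k = \<one>\<^bsub>K\<^esub>) \<and>
      (\<forall>j\<in>{1..num_v \<epsilon> g}.
        f (Vgen j) \<otimes>\<^bsub>K\<^esub> f Hgen = f Hgen [^]\<^bsub>K\<^esub> seifert_sign \<epsilon> j \<otimes>\<^bsub>K\<^esub> f (Vgen j)) \<and>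
      f Hgen [^]\<^bsub>K\<^esub> (- e) \<otimes>\<^bsub>K\<^esub>
        (word_eval K f (exceptional_word n) \<otimes>\<^bsub>K\<^esub> word_eval K f (surface_word \<epsilon> g)) = \<one>\<^bsub>K\<^esub>"
    by (simp only: 1 2 3 4 cong: ball_cong)
  finally show ?thesis
    using f unfolding seifert_tuple_def fibre_relations_def by blast
qed

lemma seifert_tuple_cong:
  assumes "\<And>x. x \<in> seifert_gens \<epsilon> g n \<Longrightarrow> f x = f' x"
  shows "seifert_tuple K e \<epsilon> g n a b f \<longleftrightarrow> seifert_tuple K e \<epsilon> g n a b f'"
proof -
  have "word_eval K f r = word_eval K f' r" if "r \<in> seifert_rels e \<epsilon> g n a b" for r
    using that seifert_rels_in_words assms by (intro word_eval_cong) blast+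
  then show ?thesis
    using assms by (simp add: seifert_tuple_def image_subset_iff)
qed

lemma seifert_tuple_elem:
  "seifert_tuple (seifert_group e \<epsilon> g n a b) e \<epsilon> g n a b (seifert_elem e \<epsilon> g n a b)"
  unfolding seifert_tuple_def seifert_group_def seifert_elem_def [abs_def]
  using seifert_rels_in_words [of e \<epsilon> g n a b]
  by (intro conjI ballI pres_gen_closed presented_group_relator) auto

lemma seifert_tuple_hom:
  assumes K: "group K" and L: "group L" and q: "q \<in> hom K L" and f: "seifert_tuple K e \<epsilon> g n a b f"
  shows "seifert_tuple L e \<epsilon> g n a b (q \<circ> f)"
proof -
  have c: "f ` seifert_gens \<epsilon> g n \<subseteq> carrier K" using f by (simp add: seifert_tuple_def)
  have "q (word_eval K f r) = q \<one>\<^bsub>K\<^esub>" if "r \<in> seifert_rels e \<epsilon> g n a b" for r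
    using f that by (simp add: seifert_tuple_def)
  moreover have "r \<in> words (seifert_gens \<epsilon> g n)" if "r \<in> seifert_rels e \<epsilon> g n a b" for r
    using that seifert_rels_in_words by blast
  ultimately show ?thesis
    using c hom_in_carrier [OF q] hom_one [OF q K L]
    unfolding seifert_tuple_def
    by (auto simp add: word_eval_hom [OF K L q c, symmetric])
qed

lemma seifert_tuple_extends:
  assumes K: "group K" and f: "seifert_tuple K e \<epsilon> g n a b f"
  obtains \<psi> where "\<psi> \<in> hom (seifert_group e \<epsilon> g n a b) K"
    "\<And>x. x \<in> seifert_gens \<epsilon> g n \<Longrightarrow> \<psi> (seifert_elem e \<epsilon> g n a b x) = f x"
proof (rule presented_group_universal [OF K, of f "seifert_gens \<epsilon> g n" "seifert_rels e \<epsilon> g n a b"])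
  show "f ` seifert_gens \<epsilon> g n \<subseteq> carrier K"
    "\<And>r. r \<in> seifert_rels e \<epsilon> g n a b \<Longrightarrow> word_eval K f r = \<one>\<^bsub>K\<^esub>"
    using f by (auto simp: seifert_tuple_def)
qed (use that in \<open>auto simp: seifert_group_def seifert_elem_def\<close>)

lemma seifert_group_is_group: "group (seifert_group e \<epsilon> g n a b)"
  by (simp add: seifert_group_def group_presented_group)

lemma seifert_group_hom_eqI:
  assumes "group K" "p \<in> hom (seifert_group e \<epsilon> g n a b) K" "q \<in> hom (seifert_group e \<epsilon> g n a b) K"
    and "\<And>x. x \<in> seifert_gens \<epsilon> g n \<Longrightarrow>
      p (seifert_elem e \<epsilon> g n a b x) = q (seifert_elem e \<epsilon> g n a b x)"
    and "y \<in> carrier (seifert_group e \<epsilon> g n a b)"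
  shows "p y = q y"
  using assms unfolding seifert_group_def seifert_elem_def by (rule presented_group_hom_eqI)

section \<open>Commuting a power of the fibre past a word\<close>

context group
begin

lemma twist_int_pow:
  assumes x: "x \<in> carrier G" and h: "h \<in> carrier G" and xh: "x \<otimes> h = h [^] (s::int) \<otimes> x"
  shows "x \<otimes> h [^] (k::int) = h [^] (s * k) \<otimes> x"
proof -
  have "(\<lambda>y. x \<otimes> y \<otimes> inv x) \<in> hom G G"
    using x by (intro homI) (auto simp: m_assoc inv_solve_left)
  then have "x \<otimes> h [^] k \<otimes> inv x = (x \<otimes> h \<otimes> inv x) [^] k"
    using hom_int_pow [of "\<lambda>y. x \<otimes> y \<otimes> inv x" G G h k] h is_group by simp
  also have "x \<otimes> h \<otimes> inv x = h [^] s"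
    using x h by (simp add: xh m_assoc)
  finally show ?thesis
    using x h by (simp add: int_pow_pow inv_solve_right')
qed

text \<open>The exponents that occur are \<open>1\<close> and \<open>-1\<close>, the integers with \<open>s * s = 1\<close>.  For them the letter
  and its inverse conjugate \<open>h\<close> in the same way.\<close>

lemma twist_int_pow_inv:
  assumes x: "x \<in> carrier G" and h: "h \<in> carrier G" and xh: "x \<otimes> h = h [^] (s::int) \<otimes> x"
    and s: "s * s = 1"
  shows "inv x \<otimes> h [^] (k::int) = h [^] (s * k) \<otimes> inv x"
proof -
  have "x \<otimes> h [^] (s * k) = h [^] k \<otimes> x"
    using twist_int_pow [OF x h xh, of "s * k"] s by (simp flip: mult.assoc)
  then have "x \<otimes> h [^] (s * k) \<otimes> inv x = h [^] k"
    using x h by (simp add: m_assoc)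
  then show ?thesis
    using x h by (auto simp: m_assoc inv_solve_left')
qed

lemma twist_swap:
  assumes x: "x \<in> carrier G" and h: "h \<in> carrier G" and xh: "x \<otimes> h = h [^] (s::int) \<otimes> x"
    and s: "s * s = 1"
  shows "h \<otimes> x = x \<otimes> h [^] s"
  using twist_int_pow [OF x h xh, of s] h by (simp add: s)

text \<open>Both letters of a commutator have the same sign \<open>s\<close> over an orientable base.  Moving the inserted
  powers of \<open>h\<close> past the letters leaves nothing for \<open>s = 1\<close> and \<open>h\<close> to the power \<open>2 (p - q)\<close> for
  \<open>s = - 1\<close>.\<close>

lemma commutator_shift:
  assumes x: "x \<in> carrier G" and y: "y \<in> carrier G" and h: "h \<in> carrier G"
    and xh: "x \<otimes> h = h [^] (s::int) \<otimes> x" and yh: "y \<otimes> h = h [^] s \<otimes> y" and s: "s * s = 1"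
  defines "C \<equiv> \<lambda>x y. x \<otimes> (y \<otimes> (inv x \<otimes> inv y))"
  shows "C (x \<otimes> h [^] (- p)) (y \<otimes> h [^] (- q)) = C x y \<otimes> h [^] ((s - 1) * (q - p))"
    and "C x y \<otimes> h = h \<otimes> C x y"
proof -
  note tw = twist_int_pow [OF x h xh] twist_int_pow [OF y h yh]
    twist_int_pow_inv [OF x h xh s] twist_int_pow_inv [OF y h yh s]
  have tw': "z \<otimes> (h [^] k \<otimes> w) = h [^] (s * k) \<otimes> (z \<otimes> w)"
    if "z \<in> {x, y, inv x, inv y}" "w \<in> carrier G" for z w and k :: int
  proof -
    have z: "z \<in> carrier G" "z \<otimes> h [^] k = h [^] (s * k) \<otimes> z" using that x y tw by auto
    then show ?thesis using that(2) h by (simp add: m_assoc [symmetric])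
  qed
  have pp: "h [^] (k::int) \<otimes> h [^] (l::int) = h [^] (k + l)"
    "w \<in> carrier G \<Longrightarrow> h [^] k \<otimes> (h [^] l \<otimes> w) = h [^] (k + l) \<otimes> w" for k l w
    using h by (simp_all add: int_pow_mult m_assoc)
  have iv: "inv (h [^] (k::int)) = h [^] (- k)" for k using h by (simp add: int_pow_neg)
  have ss: "s * (s * k) = k" for k using s by (simp flip: mult.assoc)
  show "C (x \<otimes> h [^] (- p)) (y \<otimes> h [^] (- q)) = C x y \<otimes> h [^] ((s - 1) * (q - p))"
    using x y h
    by (simp add: C_def inv_mult_group m_assoc tw tw' pp iv)
      (simp add: algebra_simps ss s)
  have "C x y \<otimes> h [^] (1::int) = h [^] (1::int) \<otimes> C x y"
    using x y h by (simp add: C_def m_assoc tw tw' pp ss s del: int_pow_1)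
  then show "C x y \<otimes> h = h \<otimes> C x y" using h by simp
qed

text \<open>The two copies of \<open>h^(- p)\<close> add up if \<open>x\<close> commutes with \<open>h\<close> and cancel if \<open>x\<close> inverts it.\<close>

lemma square_shift:
  assumes x: "x \<in> carrier G" and h: "h \<in> carrier G"
    and xh: "x \<otimes> h = h [^] (s::int) \<otimes> x" and s: "s * s = 1"
  shows "(x \<otimes> h [^] (- p)) [^] (2::int) = x [^] (2::int) \<otimes> h [^] (- (s + 1) * p)"
    and "x [^] (2::int) \<otimes> h = h \<otimes> x [^] (2::int)"
proof -
  have sq: "y [^] (2::int) = y \<otimes> y" if "y \<in> carrier G" for y
    using int_pow_mult [OF that, of 1 1] that by simp
  note tw = twist_int_pow [OF x h xh]
  have tw': "x \<otimes> (h [^] k \<otimes> w) = h [^] (s * k) \<otimes> (x \<otimes> w)" if "w \<in> carrier G" for w and k :: int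
    using that tw [of k] x h by (simp add: m_assoc [symmetric])
  have pp: "h [^] (k::int) \<otimes> h [^] (l::int) = h [^] (k + l)"
    "w \<in> carrier G \<Longrightarrow> h [^] k \<otimes> (h [^] l \<otimes> w) = h [^] (k + l) \<otimes> w" for k l w
    using h by (simp_all add: int_pow_mult m_assoc)
  have ss: "s * (s * k) = k" for k using s by (simp flip: mult.assoc)
  show "(x \<otimes> h [^] (- p)) [^] (2::int) = x [^] (2::int) \<otimes> h [^] (- (s + 1) * p)"
    using x h by (simp add: sq m_assoc tw tw' pp) (simp add: algebra_simps ss s)
  have "x [^] (2::int) \<otimes> h [^] (1::int) = h [^] (1::int) \<otimes> x [^] (2::int)"
    using x h by (simp add: sq m_assoc tw tw' pp ss s del: int_pow_1)
  then show "x [^] (2::int) \<otimes> h = h \<otimes> x [^] (2::int)" using h by simp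
qed

lemma power_shift:
  assumes x: "x \<in> carrier G" and h: "h \<in> carrier G" and xh: "x \<otimes> h = h \<otimes> x"
  shows "(x \<otimes> h [^] (- d)) [^] (a::int) \<otimes> h [^] (b + d * a) = x [^] a \<otimes> h [^] b"
proof -
  have "x \<otimes> h [^] (- d) = h [^] (- d) \<otimes> x"
    using twist_int_pow [OF x h, of 1 "- d"] xh h by simp
  from int_pow_mult_distrib [OF this x int_pow_closed [OF h]]
  have "(x \<otimes> h [^] (- d)) [^] a \<otimes> h [^] (b + d * a) =
      x [^] a \<otimes> (h [^] (- d * a) \<otimes> h [^] (b + d * a))"
    using x h by (simp only: int_pow_pow m_assoc int_pow_closed)
  also have "h [^] (- d * a) \<otimes> h [^] (b + d * a) = h [^] b"
    by (subst int_pow_mult [OF h, symmetric]) simp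
  finally show ?thesis .
qed

text \<open>The long relator is a product of blocks, each of which is a single letter, a commutator or a
  square.  As every block commutes with \<open>h\<close>, the powers of \<open>h\<close> that the blocks contribute can be moved
  to the end of the product.\<close>

lemma word_eval_blocks_shift:
  assumes f: "f ` X \<subseteq> carrier G" and f': "f' ` X \<subseteq> carrier G" and h: "h \<in> carrier G"
    and F: "\<And>i. i \<in> {1..n} \<Longrightarrow> F i \<in> words X"
    and sh: "\<And>i. i \<in> {1..n} \<Longrightarrow> word_eval G f' (F i) = word_eval G f (F i) \<otimes> h [^] (t i :: int)"
    and co: "\<And>i. i \<in> {1..n} \<Longrightarrow> word_eval G f (F i) \<otimes> h = h \<otimes> word_eval G f (F i)"
  shows "word_eval G f' (concat (map F [1..<Suc n])) =
      word_eval G f (concat (map F [1..<Suc n])) \<otimes> h [^] (\<Sum>i = 1..n. t i) \<and>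
    word_eval G f (concat (map F [1..<Suc n])) \<otimes> h = h \<otimes> word_eval G f (concat (map F [1..<Suc n]))"
  using F sh co
proof (induction n)
  case (Suc n)
  let ?W = "concat (map F [1..<Suc n])"
  have W: "?W \<in> words X" and Fn: "F (Suc n) \<in> words X" using Suc.prems(1) by (auto simp del: upt_Suc)
  have split: "concat (map F [1..<Suc (Suc n)]) = ?W @ F (Suc n)" by simp
  have cl: "word_eval G f ?W \<in> carrier G" "word_eval G f (F (Suc n)) \<in> carrier G"
    using word_eval_closed [OF is_group f] W Fn by blast+
  have co: "word_eval G f (F (Suc n)) \<otimes> h [^] k = h [^] k \<otimes> word_eval G f (F (Suc n))" for k :: int
    using twist_int_pow [OF cl(2) h, of 1 k] Suc.prems(3) [of "Suc n"] h by simp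
  define A where "A = word_eval G f ?W"
  define B where "B = word_eval G f (F (Suc n))"
  define t' where "t' = (\<Sum>i = 1..n. t i)"
  have AB: "A \<in> carrier G" "B \<in> carrier G" using cl by (simp_all only: A_def B_def)
  have co': "B \<otimes> h [^] t' = h [^] t' \<otimes> B" unfolding B_def by (rule co)
  have "word_eval G f' ?W = word_eval G f ?W \<otimes> h [^] (\<Sum>i = 1..n. t i) \<and>
      word_eval G f ?W \<otimes> h = h \<otimes> word_eval G f ?W"
    using Suc.prems by (intro Suc.IH) simp_all
  then have IH: "word_eval G f' ?W = A \<otimes> h [^] t'" and Ah: "A \<otimes> h = h \<otimes> A"
    by (simp_all only: A_def t'_def)
  have Bh: "B \<otimes> h = h \<otimes> B" unfolding B_def by (rule Suc.prems(3)) simp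
  have ABh: "A \<otimes> B \<otimes> h = h \<otimes> (A \<otimes> B)"
    using AB h by (simp only: m_assoc Bh) (simp only: m_assoc [symmetric] Ah)
  have last: "word_eval G f' (F (Suc n)) = B \<otimes> h [^] t (Suc n)"
    unfolding B_def by (rule Suc.prems(2)) simp
  have sum: "(\<Sum>i = 1..Suc n. t i) = t' + t (Suc n)" by (simp add: t'_def)
  have "A \<otimes> h [^] t' \<otimes> (B \<otimes> h [^] t (Suc n)) = A \<otimes> (h [^] t' \<otimes> B) \<otimes> h [^] t (Suc n)"
    using AB h by (simp add: m_assoc)
  also have "\<dots> = A \<otimes> B \<otimes> h [^] (t' + t (Suc n))"
    unfolding co' [symmetric] using AB h by (simp add: m_assoc int_pow_mult)
  finally have "A \<otimes> h [^] t' \<otimes> (B \<otimes> h [^] t (Suc n)) = A \<otimes> B \<otimes> h [^] (t' + t (Suc n))" .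
  with ABh show ?case
    unfolding split word_eval_append [OF is_group f W Fn] word_eval_append [OF is_group f' W Fn]
      IH last sum A_def [symmetric] B_def [symmetric] by (intro conjI)
qed (use h in simp)

end

section \<open>Shifting the generators along the fibre\<close>

text \<open>If the letter \<open>v j\<close> is multiplied by \<open>h\<close> to the power \<open>p j\<close>, then the surface word is multiplied by
  \<open>h\<close> to the power \<open>2 * surface_coeff \<epsilon> j * p j\<close>.  Over an orientable base with signs \<open>- 1\<close>
  it alternates, because the odd letters come first in their commutators.\<close>

definition surface_coeff :: "seifert_type \<Rightarrow> nat \<Rightarrow> int" where
  "surface_coeff \<epsilon> j =
     (if orientable_base \<epsilon> then (if seifert_sign \<epsilon> j = 1 then 0 else if even j then 1 else - 1)
      else if seifert_sign \<epsilon> j = 1 then 1 else 0)"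

definition shift_fibre ::
  "('a, 'm) monoid_scheme \<Rightarrow> (nat \<Rightarrow> int) \<Rightarrow> (nat \<Rightarrow> int) \<Rightarrow> (seifert_gen \<Rightarrow> 'a) \<Rightarrow> seifert_gen \<Rightarrow> 'a" where
  "shift_fibre K d p f x =
     (case x of
        Sgen k \<Rightarrow> f (Sgen k) \<otimes>\<^bsub>K\<^esub> f Hgen [^]\<^bsub>K\<^esub> (- d k)
      | Vgen j \<Rightarrow> f (Vgen j) \<otimes>\<^bsub>K\<^esub> f Hgen [^]\<^bsub>K\<^esub> (- p j)
      | Hgen \<Rightarrow> f Hgen)"

lemma shift_fibre_simps [simp]:
  "shift_fibre K d p f (Sgen k) = f (Sgen k) \<otimes>\<^bsub>K\<^esub> f Hgen [^]\<^bsub>K\<^esub> (- d k)"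
  "shift_fibre K d p f (Vgen j) = f (Vgen j) \<otimes>\<^bsub>K\<^esub> f Hgen [^]\<^bsub>K\<^esub> (- p j)"
  "shift_fibre K d p f Hgen = f Hgen"
  by (simp_all add: shift_fibre_def)

lemma shift_fibre_cong:
  "(\<And>y. y \<in> seifert_gens \<epsilon> g n \<Longrightarrow> f y = f' y) \<Longrightarrow> x \<in> seifert_gens \<epsilon> g n \<Longrightarrow>
    shift_fibre K d p f x = shift_fibre K d p f' x"
  by (cases x) (auto simp: seifert_gens_mem)

lemma shift_fibre_hom:
  assumes K: "group K" and L: "group L" and q: "q \<in> hom K L"
    and f: "f ` seifert_gens \<epsilon> g n \<subseteq> carrier K" and x: "x \<in> seifert_gens \<epsilon> g n"
  shows "q (shift_fibre K d p f x) = shift_fibre L d p (q \<circ> f) x"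
proof -
  have fx: "f x \<in> carrier K" and h: "f Hgen \<in> carrier K"
    using f x by (auto simp: seifert_gens_mem image_subset_iff)
  interpret group K by fact
  show ?thesis
    using fx h by (cases x) (simp_all add: hom_mult [OF q] hom_int_pow [OF q _ K L])
qed

lemma seifert_sign_cases: "seifert_sign \<epsilon> j = 1 \<or> seifert_sign \<epsilon> j = - 1"
  by (cases \<epsilon>) auto

lemma seifert_sign_square: "seifert_sign \<epsilon> j * seifert_sign \<epsilon> j = 1"
  using seifert_sign_cases [of \<epsilon> j] by auto

lemma sum_pairs: "(\<Sum>j = 1..2 * g. f j) = (\<Sum>i = 1..g. f (2 * i - 1) + f (2 * i))"
  for f :: "nat \<Rightarrow> 'a :: ab_group_add"
  by (induction g) (simp_all add: add.assoc)

lemma surface_exponent_orientable: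
  assumes "orientable_base \<epsilon>"
  shows "(\<Sum>i = 1..g. (seifert_sign \<epsilon> 1 - 1) * (p (2 * i) - p (2 * i - 1))) =
    - 2 * (\<Sum>j = 1..num_v \<epsilon> g. surface_coeff \<epsilon> j * p j)"
proof -
  consider "\<epsilon> = O1" | "\<epsilon> = O2" using assms by (cases \<epsilon>) auto
  then show ?thesis
  proof cases
    case 1
    then show ?thesis by (simp add: surface_coeff_def)
  next
    case 2
    have "(\<Sum>j = 1..2 * g. surface_coeff O2 j * p j) = (\<Sum>i = 1..g. p (2 * i) - p (2 * i - 1))"
      unfolding sum_pairs by (intro sum.cong) (auto simp: surface_coeff_def)
    then show ?thesis
      using 2 by (simp add: num_v_def sum_distrib_left)
  qed
qed

lemma surface_exponent_nonorientable:
  assumes "\<not> orientable_base \<epsilon>"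
  shows "(\<Sum>j = 1..g. - (seifert_sign \<epsilon> j + 1) * p j) =
    - 2 * (\<Sum>j = 1..num_v \<epsilon> g. surface_coeff \<epsilon> j * p j)"
proof -
  have "- (seifert_sign \<epsilon> j + 1) * p j = - 2 * (surface_coeff \<epsilon> j * p j)" for j
    using seifert_sign_cases [of \<epsilon> j] assms by (auto simp: surface_coeff_def)
  then show ?thesis
    using assms by (simp add: num_v_def sum_distrib_left)
qed

context group
begin

lemma fibre_relationsD:
  assumes "fibre_relations G \<epsilon> g n f"
  shows "f ` seifert_gens \<epsilon> g n \<subseteq> carrier G" and "f Hgen \<in> carrier G"
    and "k \<in> {1..n} \<Longrightarrow> f (Sgen k) \<in> carrier G"
    and "j \<in> {1..num_v \<epsilon> g} \<Longrightarrow> f (Vgen j) \<in> carrier G"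
    and "k \<in> {1..n} \<Longrightarrow> f (Sgen k) \<otimes> f Hgen = f Hgen \<otimes> f (Sgen k)"
    and "j \<in> {1..num_v \<epsilon> g} \<Longrightarrow> f (Vgen j) \<otimes> f Hgen = f Hgen [^] seifert_sign \<epsilon> j \<otimes> f (Vgen j)"
  using assms by (auto simp: fibre_relations_def seifert_gens_mem image_subset_iff)

lemma fibre_relations_shift:
  assumes f: "fibre_relations G \<epsilon> g n f"
  shows "fibre_relations G \<epsilon> g n (shift_fibre G d p f)"
proof -
  note fD = fibre_relationsD [OF f]
  have comm: "f Hgen [^] k \<otimes> f Hgen = f Hgen \<otimes> f Hgen [^] k" for k :: int
    using int_pow_mult [OF fD(2), of k 1] int_pow_mult [OF fD(2), of 1 k] fD(2)
    by (simp add: add.commute)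
  show ?thesis
    unfolding fibre_relations_def
  proof (intro conjI ballI)
    show "shift_fibre G d p f ` seifert_gens \<epsilon> g n \<subseteq> carrier G"
      using fD by (auto simp: seifert_gens_def)
    fix k assume k: "k \<in> {1..n}"
    show "shift_fibre G d p f (Sgen k) \<otimes> shift_fibre G d p f Hgen =
        shift_fibre G d p f Hgen \<otimes> shift_fibre G d p f (Sgen k)"
      using fD(2) fD(3,5) [OF k] by (simp add: m_assoc comm) (simp add: m_assoc [symmetric])
  next
    fix j assume j: "j \<in> {1..num_v \<epsilon> g}"
    show "shift_fibre G d p f (Vgen j) \<otimes> shift_fibre G d p f Hgen =
        shift_fibre G d p f Hgen [^] seifert_sign \<epsilon> j \<otimes> shift_fibre G d p f (Vgen j)"
      using fD(2) fD(4,6) [OF j] by (simp add: m_assoc comm) (simp add: m_assoc [symmetric])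
  qed
qed

lemma shift_fibre_inverse:
  assumes f: "fibre_relations G \<epsilon> g n f" and x: "x \<in> seifert_gens \<epsilon> g n"
  shows "shift_fibre G (\<lambda>k. - d k) (\<lambda>j. - p j) (shift_fibre G d p f) x = f x"
  using fibre_relationsD [OF f] x
  by (auto simp: seifert_gens_def m_assoc int_pow_mult [symmetric])

lemma word_eval_exceptional_shift:
  assumes f: "fibre_relations G \<epsilon> g n f"
  shows "word_eval G (shift_fibre G d p f) (exceptional_word n) =
    word_eval G f (exceptional_word n) \<otimes> f Hgen [^] (\<Sum>k = 1..n. - d k) \<and>
    word_eval G f (exceptional_word n) \<otimes> f Hgen = f Hgen \<otimes> word_eval G f (exceptional_word n)"
proof (rule word_eval_blocks_shift [where X = "seifert_gens \<epsilon> g n"])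
  note fD = fibre_relationsD [OF f] and fD' = fibre_relationsD [OF fibre_relations_shift [OF f]]
  show "f ` seifert_gens \<epsilon> g n \<subseteq> carrier G" "f Hgen \<in> carrier G" by (fact fD)+
  show "shift_fibre G d p f ` seifert_gens \<epsilon> g n \<subseteq> carrier G" by (fact fD')
  fix i assume i: "i \<in> {1..n}"
  show "letter (Sgen i) \<in> words (seifert_gens \<epsilon> g n)" using i by (simp add: seifert_gens_mem)
  show "word_eval G (shift_fibre G d p f) (letter (Sgen i)) =
      word_eval G f (letter (Sgen i)) \<otimes> f Hgen [^] (- d i)"
    using fD(2) fD(3) [OF i] by simp
  show "word_eval G f (letter (Sgen i)) \<otimes> f Hgen = f Hgen \<otimes> word_eval G f (letter (Sgen i))"
    using fD(2) fD(3,5) [OF i] by simp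
qed

lemma word_eval_surface_shift:
  assumes f: "fibre_relations G \<epsilon> g n f"
  shows "word_eval G (shift_fibre G d p f) (surface_word \<epsilon> g) =
    word_eval G f (surface_word \<epsilon> g) \<otimes>
      f Hgen [^] (- 2 * (\<Sum>j = 1..num_v \<epsilon> g. surface_coeff \<epsilon> j * p j)) \<and>
    word_eval G f (surface_word \<epsilon> g) \<otimes> f Hgen = f Hgen \<otimes> word_eval G f (surface_word \<epsilon> g)"
proof -
  note fD = fibre_relationsD [OF f] and fD' = fibre_relationsD [OF fibre_relations_shift [OF f]]
  have let_in: "letter (Vgen j) \<in> words (seifert_gens \<epsilon> g n)" if "j \<in> {1..num_v \<epsilon> g}" for j
    using that by (simp add: seifert_gens_mem)
  have let_ev: "word_eval G f (letter (Vgen j)) = f (Vgen j)"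
    "word_eval G (shift_fibre G d p f) (letter (Vgen j)) = f (Vgen j) \<otimes> f Hgen [^] (- p j)"
    if "j \<in> {1..num_v \<epsilon> g}" for j
    using fD(2) fD(4) [OF that] by simp_all
  show ?thesis
  proof (cases "orientable_base \<epsilon>")
    case True
    have sg: "seifert_sign \<epsilon> i = seifert_sign \<epsilon> 1" for i using True by (cases \<epsilon>) auto
    let ?F = "\<lambda>i. word_comm (letter (Vgen (2 * i - 1))) (letter (Vgen (2 * i)))"
    have surface: "surface_word \<epsilon> g = concat (map ?F [1..<Suc g])"
      by (simp only: surface_word_def True if_True)
    show ?thesis
      unfolding surface surface_exponent_orientable [OF True, of p g, symmetric]
    proof (rule word_eval_blocks_shift [OF fD(1) fD'(1) fD(2)])
      fix i assume i: "i \<in> {1..g}"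
      have r: "2 * i - 1 \<in> {1..num_v \<epsilon> g}" "2 * i \<in> {1..num_v \<epsilon> g}"
        using i True by (auto simp: num_v_def)
      show "?F i \<in> words (seifert_gens \<epsilon> g n)" by (intro word_comm_in_words let_in r)
      have eval: "word_eval G f (?F i) = f (Vgen (2 * i - 1)) \<otimes>
          (f (Vgen (2 * i)) \<otimes> (inv (f (Vgen (2 * i - 1))) \<otimes> inv (f (Vgen (2 * i)))))"
        unfolding word_eval_comm [OF fD(1) let_in [OF r(1)] let_in [OF r(2)]]
          let_ev(1) [OF r(1)] let_ev(1) [OF r(2)] ..
      have eval': "word_eval G (shift_fibre G d p f) (?F i) =
          (f (Vgen (2 * i - 1)) \<otimes> f Hgen [^] (- p (2 * i - 1))) \<otimes>
          ((f (Vgen (2 * i)) \<otimes> f Hgen [^] (- p (2 * i))) \<otimes>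
           (inv (f (Vgen (2 * i - 1)) \<otimes> f Hgen [^] (- p (2 * i - 1))) \<otimes>
            inv (f (Vgen (2 * i)) \<otimes> f Hgen [^] (- p (2 * i)))))"
        unfolding word_eval_comm [OF fD'(1) let_in [OF r(1)] let_in [OF r(2)]]
          let_ev(2) [OF r(1)] let_ev(2) [OF r(2)] ..
      note twist = fD(6) [OF r(1), unfolded sg [of "2 * i - 1"]] fD(6) [OF r(2), unfolded sg [of "2 * i"]]
      note shift = commutator_shift [OF fD(4) [OF r(1)] fD(4) [OF r(2)] fD(2) twist seifert_sign_square]
      show "word_eval G (shift_fibre G d p f) (?F i) = word_eval G f (?F i) \<otimes>
          f Hgen [^] ((seifert_sign \<epsilon> 1 - 1) * (p (2 * i) - p (2 * i - 1)))"
        unfolding eval eval' by (rule shift(1))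
      show "word_eval G f (?F i) \<otimes> f Hgen = f Hgen \<otimes> word_eval G f (?F i)"
        unfolding eval by (rule shift(2))
    qed
  next
    case False
    let ?F = "\<lambda>j. word_pow (letter (Vgen j)) 2"
    have surface: "surface_word \<epsilon> g = concat (map ?F [1..<Suc g])"
      by (simp only: surface_word_def False if_False)
    show ?thesis
      unfolding surface surface_exponent_nonorientable [OF False, of p g, symmetric]
    proof (rule word_eval_blocks_shift [OF fD(1) fD'(1) fD(2)])
      fix j assume "j \<in> {1..g}"
      then have r: "j \<in> {1..num_v \<epsilon> g}" using False by (simp add: num_v_def)
      show "?F j \<in> words (seifert_gens \<epsilon> g n)" by (intro word_pow_in_words let_in r)
      have eval: "word_eval G f (?F j) = f (Vgen j) [^] (2::int)"
        unfolding word_eval_pow [OF fD(1) let_in [OF r]] let_ev(1) [OF r] ..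
      have eval': "word_eval G (shift_fibre G d p f) (?F j) =
          (f (Vgen j) \<otimes> f Hgen [^] (- p j)) [^] (2::int)"
        unfolding word_eval_pow [OF fD'(1) let_in [OF r]] let_ev(2) [OF r] ..
      note shift = square_shift [OF fD(4) [OF r] fD(2) fD(6) [OF r] seifert_sign_square]
      show "word_eval G (shift_fibre G d p f) (?F j) =
          word_eval G f (?F j) \<otimes> f Hgen [^] (- (seifert_sign \<epsilon> j + 1) * p j)"
        unfolding eval eval' by (rule shift(1))
      show "word_eval G f (?F j) \<otimes> f Hgen = f Hgen \<otimes> word_eval G f (?F j)"
        unfolding eval by (rule shift(2))
    qed
  qed
qed

text \<open>This is the group-theoretic form of the fact that different invariants can describe the same
  Seifert manifold: twisting the sections around the exceptional fibres by \<open>d\<close> and along the base by \<open>p\<close>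
  changes \<open>b\<close> and \<open>e\<close>, but neither the type nor \<open>a\<close>.\<close>

lemma seifert_tuple_shift:
  assumes f: "seifert_tuple G e \<epsilon> g n a b f"
    and e': "e' = e - (\<Sum>k = 1..n. d k) - 2 * (\<Sum>j = 1..num_v \<epsilon> g. surface_coeff \<epsilon> j * p j)"
    and b': "\<And>k. k \<in> {1..n} \<Longrightarrow> b' k = b k + d k * a k"
  shows "seifert_tuple G e' \<epsilon> g n a b' (shift_fibre G d p f)"
proof -
  note tuple = f [unfolded seifert_tuple_iff [OF is_group]]
  then have fr: "fibre_relations G \<epsilon> g n f" by (rule conjunct1)
  note fD = fibre_relationsD [OF fr]
  let ?h = "f Hgen"
  have pow: "(f (Sgen k) \<otimes> ?h [^] (- d k)) [^] a k \<otimes> ?h [^] b' k = f (Sgen k) [^] a k \<otimes> ?h [^] b k"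
    if k: "k \<in> {1..n}" for k
    unfolding b' [OF k] by (rule power_shift [OF fD(3) [OF k] fD(2) fD(5) [OF k]])
  define S where "S = word_eval G f (exceptional_word n)"
  define V where "V = word_eval G f (surface_word \<epsilon> g)"
  define D where "D = (\<Sum>k = 1..n. d k)"
  define C where "C = (\<Sum>j = 1..num_v \<epsilon> g. surface_coeff \<epsilon> j * p j)"
  have S: "S \<in> carrier G" and V: "V \<in> carrier G"
    unfolding S_def V_def
    by (intro word_eval_closed [OF is_group fD(1)] exceptional_word_in_seifert_words
      surface_word_in_seifert_words)+
  have SV: "word_eval G (shift_fibre G d p f) (exceptional_word n) = S \<otimes> ?h [^] (- D)"
    "word_eval G (shift_fibre G d p f) (surface_word \<epsilon> g) = V \<otimes> ?h [^] (- 2 * C)"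
    and Sh: "S \<otimes> ?h = ?h \<otimes> S" and Vh: "V \<otimes> ?h = ?h \<otimes> V"
    using word_eval_exceptional_shift [OF fr, of d p] word_eval_surface_shift [OF fr, of d p]
    by (simp_all only: S_def V_def D_def C_def sum_negf)
  have comm: "V \<otimes> ?h [^] k = ?h [^] k \<otimes> V" "S \<otimes> ?h [^] k = ?h [^] k \<otimes> S" for k :: int
    using twist_int_pow [OF V fD(2), of 1 k] twist_int_pow [OF S fD(2), of 1 k] fD(2) Sh Vh
    by simp_all
  have "?h [^] (- e') \<otimes> ((S \<otimes> ?h [^] (- D)) \<otimes> (V \<otimes> ?h [^] (- 2 * C))) =
      ?h [^] (- e') \<otimes> (?h [^] (- D) \<otimes> (?h [^] (- 2 * C) \<otimes> (S \<otimes> V)))"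
  proof -
    have "(S \<otimes> ?h [^] (- D)) \<otimes> (V \<otimes> ?h [^] (- 2 * C)) =
        (?h [^] (- D) \<otimes> S) \<otimes> (?h [^] (- 2 * C) \<otimes> V)"
      by (simp only: comm(2) [of "- D"] comm(1) [of "- 2 * C"])
    also have "\<dots> = ?h [^] (- D) \<otimes> ((S \<otimes> ?h [^] (- 2 * C)) \<otimes> V)"
      using S V fD(2) by (simp only: m_assoc m_closed int_pow_closed)
    also have "\<dots> = ?h [^] (- D) \<otimes> (?h [^] (- 2 * C) \<otimes> (S \<otimes> V))"
      using S V fD(2) by (simp only: comm(2) [of "- 2 * C"] m_assoc m_closed int_pow_closed)
    finally show ?thesis by (simp only:)
  qed
  also have "\<dots> = (?h [^] (- e') \<otimes> (?h [^] (- D) \<otimes> ?h [^] (- 2 * C))) \<otimes> (S \<otimes> V)"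
    using S V fD(2) by (simp only: m_assoc m_closed int_pow_closed)
  also have "\<dots> = ?h [^] (- e) \<otimes> (S \<otimes> V)"
  proof -
    have "- e' + (- D + - 2 * C) = - e" by (simp add: e' D_def C_def)
    then have "?h [^] (- e') \<otimes> (?h [^] (- D) \<otimes> ?h [^] (- 2 * C)) = ?h [^] (- e)"
      by (simp only: int_pow_mult [OF fD(2), symmetric])
    then show ?thesis by (simp only:)
  qed
  also have "\<dots> = \<one>"
    unfolding S_def V_def by (rule conjunct2 [OF conjunct2 [OF tuple]])
  finally have "?h [^] (- e') \<otimes> ((S \<otimes> ?h [^] (- D)) \<otimes> (V \<otimes> ?h [^] (- 2 * C))) = \<one>" .
  moreover have "\<forall>k\<in>{1..n}. f (Sgen k) [^] a k \<otimes> ?h [^] b k = \<one>"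
    by (rule conjunct1 [OF conjunct2 [OF tuple]])
  ultimately show ?thesis
    unfolding seifert_tuple_iff [OF is_group] shift_fibre_simps SV
    using fibre_relations_shift [OF fr, of d p] pow by (intro conjI ballI) simp_all
qed

end

section \<open>Replacing the fibre by its square\<close>

lemma (in group) fibre_relations_square_fibre:
  assumes f: "fibre_relations G \<epsilon> g n f"
  shows "fibre_relations G \<epsilon> g n (f(Hgen := f Hgen [^] (2::int)))"
proof -
  note fD = fibre_relationsD [OF f]
  have "f (Sgen k) \<otimes> f Hgen [^] (2::int) = f Hgen [^] (2::int) \<otimes> f (Sgen k)" if k: "k \<in> {1..n}" for k
    using twist_int_pow [OF fD(3) [OF k] fD(2), of 1 2] fD(2) fD(5) [OF k] by simp
  moreover have "f (Vgen j) \<otimes> f Hgen [^] (2::int) =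
      (f Hgen [^] (2::int)) [^] seifert_sign \<epsilon> j \<otimes> f (Vgen j)" if j: "j \<in> {1..num_v \<epsilon> g}" for j
    using twist_int_pow [OF fD(4) [OF j] fD(2) fD(6) [OF j], of 2] fD(2)
    by (simp add: int_pow_pow mult.commute)
  moreover have "f(Hgen := f Hgen [^] (2::int)) ` seifert_gens \<epsilon> g n \<subseteq> carrier G"
    using fD(2-4) by (auto simp: seifert_gens_def)
  ultimately show ?thesis
    by (simp add: fibre_relations_def)
qed

text \<open>If \<open>2 * e\<close> and \<open>2 * b k\<close> are the exponents of the fibre in the relators, only its square is seen by
  them.  The relations that involve the fibre itself are the hypothesis: they imply those for the square,
  but do not follow from them.\<close>

lemma (in group) seifert_tuple_square_fibre:
  assumes f: "fibre_relations G \<epsilon> g n f"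
  shows "seifert_tuple G e \<epsilon> g n a b (f(Hgen := f Hgen [^] (2::int))) \<longleftrightarrow>
    seifert_tuple G (2 * e) \<epsilon> g n a (\<lambda>k. 2 * b k) f"
proof -
  note fD = fibre_relationsD [OF f]
  let ?f = "f(Hgen := f Hgen [^] (2::int))"
  have ev: "word_eval G ?f (exceptional_word n) = word_eval G f (exceptional_word n)"
    "word_eval G ?f (surface_word \<epsilon> g) = word_eval G f (surface_word \<epsilon> g)"
    by (rule word_eval_cong [OF exceptional_word_in_words] word_eval_cong [OF surface_word_in_words];
      fastforce)+
  have S: "?f (Sgen k) = f (Sgen k)" for k by simp
  have H: "?f Hgen [^] k = f Hgen [^] (2 * k)" for k :: int
    using fD(2) by (simp add: int_pow_pow)
  have e: "2 * - e = - (2 * e)" by simp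
  show ?thesis
    using f fibre_relations_square_fibre [OF f]
    unfolding seifert_tuple_iff [OF is_group] ev S H e by blast
qed

section \<open>Adjoining a square root to a group\<close>

text \<open>The pair \<open>(x, i)\<close> stands for \<open>x r\<^sup>i\<close>, where \<open>r\<close> is a new element with \<open>r x = \<alpha> x r\<close> and
  \<open>r\<^sup>2 = z\<close>; the Boolean is an exponent modulo 2 and \<open>z\<close> is the carry.\<close>

definition root_extension ::
  "('a, 'm) monoid_scheme \<Rightarrow> ('a \<Rightarrow> 'a) \<Rightarrow> 'a \<Rightarrow> ('a \<times> bool) monoid" where
  "root_extension A \<alpha> z =
     \<lparr>carrier = carrier A \<times> UNIV,
      monoid.mult = (\<lambda>(x, i) (y, j).
        (x \<otimes>\<^bsub>A\<^esub> ((if i then \<alpha> y else y) \<otimes>\<^bsub>A\<^esub> (if i \<and> j then z else \<one>\<^bsub>A\<^esub>)), i \<noteq> j)),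
      one = (\<one>\<^bsub>A\<^esub>, False)\<rparr>"

lemma root_extension_simps [simp]:
  "p \<in> carrier (root_extension A \<alpha> z) \<longleftrightarrow> fst p \<in> carrier A"
  "(x, i) \<otimes>\<^bsub>root_extension A \<alpha> z\<^esub> (y, j) =
     (x \<otimes>\<^bsub>A\<^esub> ((if i then \<alpha> y else y) \<otimes>\<^bsub>A\<^esub> (if i \<and> j then z else \<one>\<^bsub>A\<^esub>)), i \<noteq> j)"
  "\<one>\<^bsub>root_extension A \<alpha> z\<^esub> = (\<one>\<^bsub>A\<^esub>, False)"
  by (cases p) (auto simp: root_extension_def)

text \<open>The conditions that conjugation by a root \<open>r\<close> of \<open>z\<close> must satisfy: \<open>r\<close> commutes with its square,
  and conjugating twice by \<open>r\<close> is conjugating by \<open>z\<close>.  They are also sufficient for the existence of a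
  group with such a root.\<close>

locale square_root_data = group A for A (structure) +
  fixes \<alpha> :: "'a \<Rightarrow> 'a" and z :: 'a
  assumes alpha_hom: "\<alpha> \<in> hom A A" and z_closed [simp]: "z \<in> carrier A"
    and alpha_z: "\<alpha> z = z"
    and alpha_alpha: "x \<in> carrier A \<Longrightarrow> \<alpha> (\<alpha> x) \<otimes> z = z \<otimes> x"
begin

abbreviation "E \<equiv> root_extension A \<alpha> z"

lemma alpha_closed [simp]: "x \<in> carrier A \<Longrightarrow> \<alpha> x \<in> carrier A"
  using alpha_hom by (rule hom_in_carrier)

lemma alpha_mult: "x \<in> carrier A \<Longrightarrow> y \<in> carrier A \<Longrightarrow> \<alpha> (x \<otimes> y) = \<alpha> x \<otimes> \<alpha> y"
  using alpha_hom by (rule hom_mult)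

lemma alpha_one: "\<alpha> \<one> = \<one>"
  by (rule hom_one [OF alpha_hom is_group is_group])

text \<open>In the associative law, \<open>alpha_z\<close> and \<open>alpha_alpha\<close> are what is needed to compare the two ways of
  moving a carry past the factors.\<close>

lemma group_root_extension: "group E"
proof (rule groupI)
  fix p q r assume "p \<in> carrier E" "q \<in> carrier E" "r \<in> carrier E"
  then obtain x y w i j k
    where pqr: "p = (x, i)" "q = (y, j)" "r = (w, k)" "x \<in> carrier A" "y \<in> carrier A" "w \<in> carrier A"
    by (metis prod.collapse root_extension_simps(1))
  have aa: "\<alpha> (\<alpha> w) \<otimes> z = z \<otimes> w" by (rule alpha_alpha) fact
  show "p \<otimes>\<^bsub>E\<^esub> q \<otimes>\<^bsub>E\<^esub> r = p \<otimes>\<^bsub>E\<^esub> (q \<otimes>\<^bsub>E\<^esub> r)"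
    using pqr(4-6) by (cases i; cases j; cases k) (simp_all add: pqr m_assoc alpha_mult alpha_one alpha_z aa)
next
  fix p assume p: "p \<in> carrier E"
  obtain x i where pe: "p = (x, i)" by (cases p)
  have x: "x \<in> carrier A" using p pe by simp
  define q where "q = (if i then (inv (\<alpha> x \<otimes> z), True) else (inv x, False))"
  have "q \<in> carrier E" "q \<otimes>\<^bsub>E\<^esub> p = \<one>\<^bsub>E\<^esub>"
    using x by (auto simp: q_def pe)
  then show "\<exists>q\<in>carrier E. q \<otimes>\<^bsub>E\<^esub> p = \<one>\<^bsub>E\<^esub>" by blast
qed (auto simp: alpha_one)

lemma embedding_hom: "(\<lambda>x. (x, False)) \<in> hom A E"
  by (rule homI) auto

lemma root_square: "(\<one>, True) [^]\<^bsub>E\<^esub> (2::int) = (z, False)"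
proof -
  interpret E: group E by (rule group_root_extension)
  have "(\<one>, True) [^]\<^bsub>E\<^esub> (2::int) = (\<one>, True) \<otimes>\<^bsub>E\<^esub> (\<one>, True)"
    using E.int_pow_mult [of "(\<one>, True)" 1 1] by simp
  then show ?thesis by (simp add: alpha_one)
qed

text \<open>A homomorphism on \<open>A\<close> extends to \<open>E\<close> as soon as the target has a root of \<open>\<psi> z\<close> that acts on the image
  of \<open>\<psi>\<close> in the way prescribed by \<open>\<alpha>\<close>.\<close>

lemma root_extension_hom:
  assumes L: "group L" and \<psi>: "\<psi> \<in> hom A L" and h: "h \<in> carrier L"
    and hh: "h \<otimes>\<^bsub>L\<^esub> h = \<psi> z"
    and h\<psi>: "\<And>x. x \<in> carrier A \<Longrightarrow> h \<otimes>\<^bsub>L\<^esub> \<psi> x = \<psi> (\<alpha> x) \<otimes>\<^bsub>L\<^esub> h"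
  shows "(\<lambda>(x, i). \<psi> x \<otimes>\<^bsub>L\<^esub> (if i then h else \<one>\<^bsub>L\<^esub>)) \<in> hom E L"
proof (rule homI)
  interpret L: group L by fact
  note c = hom_in_carrier [OF \<psi>]
  show "(case p of (x, i) \<Rightarrow> \<psi> x \<otimes>\<^bsub>L\<^esub> (if i then h else \<one>\<^bsub>L\<^esub>)) \<in> carrier L" if "p \<in> carrier E" for p
    using that c h by (cases p) auto
  fix p q assume pq: "p \<in> carrier E" "q \<in> carrier E"
  obtain x i y j where e: "p = (x, i)" "q = (y, j)" by (metis prod.collapse)
  have xy: "x \<in> carrier A" "y \<in> carrier A" using pq e by auto
  have h\<psi>': "h \<otimes>\<^bsub>L\<^esub> (\<psi> y \<otimes>\<^bsub>L\<^esub> w) = \<psi> (\<alpha> y) \<otimes>\<^bsub>L\<^esub> (h \<otimes>\<^bsub>L\<^esub> w)" if "w \<in> carrier L" for w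
    using that h\<psi> [OF xy(2)] c [OF xy(2)] c [OF alpha_closed [OF xy(2)]] h
    by (simp add: L.m_assoc [symmetric])
  show "(case p \<otimes>\<^bsub>E\<^esub> q of (x, i) \<Rightarrow> \<psi> x \<otimes>\<^bsub>L\<^esub> (if i then h else \<one>\<^bsub>L\<^esub>)) =
      (case p of (x, i) \<Rightarrow> \<psi> x \<otimes>\<^bsub>L\<^esub> (if i then h else \<one>\<^bsub>L\<^esub>)) \<otimes>\<^bsub>L\<^esub>
      (case q of (x, i) \<Rightarrow> \<psi> x \<otimes>\<^bsub>L\<^esub> (if i then h else \<one>\<^bsub>L\<^esub>))"
    using xy h c by (cases i; cases j) (simp_all add: e hom_mult [OF \<psi>] L.m_assoc h\<psi>' h\<psi> hh)
qed

text \<open>By the hypotheses on \<open>\<Phi>\<close>, every element of \<open>L\<close> has the form \<open>\<psi> x\<close> or \<open>\<psi> x h\<close>.  As \<open>\<phi>\<close> vanishes on the first kind and is \<open>1\<close> on the second, its kernel is the image of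
  \<open>\<psi>\<close>; and \<open>\<psi>\<close> is injective because \<open>\<Phi>\<close> recovers \<open>x\<close> from \<open>\<psi> x\<close>.\<close>

lemma kernel_iso:
  assumes L: "group L" and \<psi>: "\<psi> \<in> hom A L" and h: "h \<in> carrier L"
    and \<Phi>: "\<Phi> \<in> hom L E"
    and \<Phi>\<psi>: "\<And>x. x \<in> carrier A \<Longrightarrow> \<Phi> (\<psi> x) = (x, False)"
    and \<Psi>\<Phi>: "\<And>y. y \<in> carrier L \<Longrightarrow>
      (case \<Phi> y of (x, i) \<Rightarrow> \<psi> x \<otimes>\<^bsub>L\<^esub> (if i then h else \<one>\<^bsub>L\<^esub>)) = y"
    and \<phi>: "\<phi> \<in> hom L (integer_mod_group 2)" and \<phi>h: "\<phi> h = 1"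
    and \<phi>\<psi>: "\<And>x. x \<in> carrier A \<Longrightarrow> \<phi> (\<psi> x) = 0"
  shows "\<psi> \<in> iso A (L\<lparr>carrier := kernel L (integer_mod_group 2) \<phi>\<rparr>)"
proof -
  interpret L: group L by fact
  have inj: "inj_on \<psi> (carrier A)"
    using \<Phi>\<psi> by (metis inj_onI prod.inject)
  have "\<psi> ` carrier A = kernel L (integer_mod_group 2) \<phi>"
  proof
    show "\<psi> ` carrier A \<subseteq> kernel L (integer_mod_group 2) \<phi>"
      using hom_in_carrier [OF \<psi>] \<phi>\<psi> by (auto simp: kernel_def)
    show "kernel L (integer_mod_group 2) \<phi> \<subseteq> \<psi> ` carrier A"
    proof
      fix y assume "y \<in> kernel L (integer_mod_group 2) \<phi>"
      then have y: "y \<in> carrier L" "\<phi> y = 0" by (auto simp: kernel_def)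
      obtain x i where xi: "\<Phi> y = (x, i)" by (cases "\<Phi> y")
      have x: "x \<in> carrier A" using hom_in_carrier [OF \<Phi> y(1)] xi by simp
      have yx: "y = \<psi> x \<otimes>\<^bsub>L\<^esub> (if i then h else \<one>\<^bsub>L\<^esub>)" using \<Psi>\<Phi> [OF y(1)] xi by simp
      have "\<not> i"
      proof
        assume i
        then have "\<phi> y = 1"
          using yx hom_mult [OF \<phi> hom_in_carrier [OF \<psi> x] h] \<phi>h \<phi>\<psi> [OF x] by simp
        with y show False by simp
      qed
      then show "y \<in> \<psi> ` carrier A" using yx x hom_in_carrier [OF \<psi> x] by auto
    qed
  qed
  then show ?thesis
    using \<psi> inj by (auto simp: iso_def hom_def bij_betw_def)
qed

end

section \<open>The kernel as a Seifert group\<close>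

text \<open>Conjugation by the fibre multiplies the letter \<open>v j\<close> on the right by \<open>h\<close> to the power
  \<open>seifert_sign \<epsilon> j - 1\<close>.  This number is even, and \<open>flip \<epsilon> j\<close> is minus its half.  So the shift by \<open>flip\<close> is
  what conjugation by a square root of the fibre has to be, if the letters act on the root as they do on
  the fibre.\<close>

definition flip :: "seifert_type \<Rightarrow> nat \<Rightarrow> int" where
  "flip \<epsilon> j = (if seifert_sign \<epsilon> j = 1 then 0 else 1)"

lemma sign_eq_flip: "seifert_sign \<epsilon> j = 1 - 2 * flip \<epsilon> j"
  using seifert_sign_cases [of \<epsilon> j] by (auto simp: flip_def)

text \<open>Conjugation by a root does not move \<open>e\<close>: over an orientable base with signs \<open>- 1\<close> the two
  letters of each commutator contribute with opposite signs, and over a non-orientable base only letters with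
  sign \<open>1\<close> have a non-zero coefficient.\<close>

lemma surface_coeff_flip: "(\<Sum>j = 1..num_v \<epsilon> g. surface_coeff \<epsilon> j * flip \<epsilon> j) = 0"
proof (cases "orientable_base \<epsilon>")
  case True
  have "(\<Sum>j = 1..num_v \<epsilon> g. surface_coeff \<epsilon> j * flip \<epsilon> j) =
      (\<Sum>i = 1..g. surface_coeff \<epsilon> (2 * i - 1) * flip \<epsilon> (2 * i - 1) + surface_coeff \<epsilon> (2 * i) * flip \<epsilon> (2 * i))"
    unfolding num_v_def if_P [OF True] by (rule sum_pairs)
  also have "\<dots> = 0"
    using True by (intro sum.neutral ballI) (cases \<epsilon>; simp add: surface_coeff_def flip_def)
  finally show ?thesis .
next
  case False
  then show ?thesis by (intro sum.neutral ballI) (simp add: surface_coeff_def flip_def)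
qed

lemma (in group) conjugation_by_fibre:
  assumes f: "fibre_relations G \<epsilon> g n f" and x: "x \<in> seifert_gens \<epsilon> g n"
  shows "f Hgen \<otimes> f x = shift_fibre G (\<lambda>k. 0) (\<lambda>j. 2 * flip \<epsilon> j) f x \<otimes> f Hgen"
proof -
  note fD = fibre_relationsD [OF f]
  show ?thesis
  proof (cases x)
    case (Sgen k)
    then have k: "k \<in> {1..n}" using x by (simp add: seifert_gens_mem)
    show ?thesis using Sgen fD(2) fD(3,5) [OF k] by simp
  next
    case (Vgen j)
    then have j: "j \<in> {1..num_v \<epsilon> g}" using x by (simp add: seifert_gens_mem)
    have "f Hgen \<otimes> f x = f (Vgen j) \<otimes> f Hgen [^] (- (2 * flip \<epsilon> j) + 1)"
      using twist_swap [OF fD(4) [OF j] fD(2) fD(6) [OF j] seifert_sign_square]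
      by (simp add: Vgen sign_eq_flip)
    also have "\<dots> = f (Vgen j) \<otimes> f Hgen [^] (- (2 * flip \<epsilon> j)) \<otimes> f Hgen"
      unfolding int_pow_mult [OF fD(2)] using fD(2) fD(4) [OF j] by (simp add: m_assoc)
    finally show ?thesis by (simp add: Vgen)
  next
    case Hgen
    then show ?thesis by simp
  qed
qed

text \<open>The shift by \<open>flip\<close> preserves the invariants by \<open>surface_coeff_flip\<close>, hence defines an endomorphism
  \<open>\<alpha>\<close>.  Applying it twice shifts by \<open>2 * flip\<close>, which is conjugation by the fibre on generators and
  therefore everywhere.\<close>

lemma fibre_root_automorphism:
  fixes e \<epsilon> g n a b
  defines "A \<equiv> seifert_group e \<epsilon> g n a b" and "x \<equiv> seifert_elem e \<epsilon> g n a b"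
  obtains \<alpha> where "square_root_data A \<alpha> (x Hgen)"
    "\<And>y. y \<in> seifert_gens \<epsilon> g n \<Longrightarrow> \<alpha> (x y) = shift_fibre A (\<lambda>k. 0) (flip \<epsilon>) x y"
proof -
  interpret A: group A unfolding A_def by (rule seifert_group_is_group)
  note hom_eqI = seifert_group_hom_eqI [where e = e and \<epsilon> = \<epsilon> and g = g and n = n and a = a and b = b,
      folded A_def x_def]
  have tup: "seifert_tuple A e \<epsilon> g n a b x" unfolding A_def x_def by (rule seifert_tuple_elem)
  then have fr: "fibre_relations A \<epsilon> g n x" by (simp only: seifert_tuple_iff [OF A.is_group])
  note xD = A.fibre_relationsD [OF fr]
  have shifted: "seifert_tuple A e \<epsilon> g n a b (shift_fibre A (\<lambda>k. 0) (flip \<epsilon>) x)"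
    by (rule A.seifert_tuple_shift [OF tup]) (simp_all only: surface_coeff_flip, simp_all)
  obtain \<alpha> where \<alpha>: "\<alpha> \<in> hom A A"
    and \<alpha>x: "\<And>y. y \<in> seifert_gens \<epsilon> g n \<Longrightarrow> \<alpha> (x y) = shift_fibre A (\<lambda>k. 0) (flip \<epsilon>) x y"
    by (rule seifert_tuple_extends [OF A.is_group shifted, folded A_def x_def], rule that)
  have \<alpha>H: "\<alpha> (x Hgen) = x Hgen" using \<alpha>x [of Hgen] by (simp add: seifert_gens_mem)
  have \<alpha>\<alpha>x: "\<alpha> (\<alpha> (x y)) = shift_fibre A (\<lambda>k. 0) (\<lambda>j. 2 * flip \<epsilon> j) x y"
    if y: "y \<in> seifert_gens \<epsilon> g n" for y
  proof -
    have xy: "x y \<in> carrier A" using xD(1) y by (auto simp: image_subset_iff)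
    have "\<alpha> (\<alpha> (x y)) = shift_fibre A (\<lambda>k. 0) (flip \<epsilon>) (\<alpha> \<circ> x) y"
      unfolding \<alpha>x [OF y] by (rule shift_fibre_hom [OF A.is_group A.is_group \<alpha> xD(1) y])
    also have "\<dots> = shift_fibre A (\<lambda>k. 0) (flip \<epsilon>) (shift_fibre A (\<lambda>k. 0) (flip \<epsilon>) x) y"
      by (rule shift_fibre_cong [OF _ y]) (simp add: \<alpha>x)
    also have "\<dots> = shift_fibre A (\<lambda>k. 0) (\<lambda>j. 2 * flip \<epsilon> j) x y"
      using xy xD(2) by (cases y) (simp_all add: A.m_assoc A.int_pow_mult [symmetric])
    finally show ?thesis .
  qed
  \<comment> \<open>Conjugation is written as a homomorphism in order to compare it with \<open>\<alpha> \<circ> \<alpha>\<close> on generators.\<close>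
  have conj_hom: "(\<lambda>w. x Hgen \<otimes>\<^bsub>A\<^esub> w \<otimes>\<^bsub>A\<^esub> inv\<^bsub>A\<^esub> x Hgen) \<in> hom A A"
    using xD(2) by (intro homI) (auto simp: A.m_assoc A.inv_solve_left)
  have "\<alpha> (\<alpha> w) \<otimes>\<^bsub>A\<^esub> x Hgen = x Hgen \<otimes>\<^bsub>A\<^esub> w" if w: "w \<in> carrier A" for w
  proof -
    have "(\<alpha> \<circ> \<alpha>) w = x Hgen \<otimes>\<^bsub>A\<^esub> w \<otimes>\<^bsub>A\<^esub> inv\<^bsub>A\<^esub> x Hgen"
    proof (rule hom_eqI [where p = "\<alpha> \<circ> \<alpha>" and
          q = "\<lambda>w. x Hgen \<otimes>\<^bsub>A\<^esub> w \<otimes>\<^bsub>A\<^esub> inv\<^bsub>A\<^esub> x Hgen" and K = A, OF A.is_group])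
      fix y assume y: "y \<in> seifert_gens \<epsilon> g n"
      have "\<alpha> (\<alpha> (x y)) \<in> carrier A"
        using hom_in_carrier [OF \<alpha>] xD(1) y by (auto simp: image_subset_iff)
      then show "(\<alpha> \<circ> \<alpha>) (x y) = x Hgen \<otimes>\<^bsub>A\<^esub> x y \<otimes>\<^bsub>A\<^esub> inv\<^bsub>A\<^esub> x Hgen"
        unfolding A.conjugation_by_fibre [OF fr y] \<alpha>\<alpha>x [OF y, symmetric]
        using xD(2) by (simp add: A.m_assoc)
    qed (use w conj_hom Group.hom_compose [OF \<alpha> \<alpha>] in simp_all)
    then show ?thesis
      using w xD(2) hom_in_carrier [OF \<alpha>] by (simp add: A.m_assoc)
  qed
  then have "square_root_data A \<alpha> (x Hgen)"
    using \<alpha> \<alpha>H xD(2) by unfold_locales auto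
  then show thesis using \<alpha>x by (rule that)
qed

text \<open>The general form of the result: any lift \<open>d\<close>, \<open>p\<close> of the values of \<open>\<phi>\<close> to the integers describes
  the kernel, provided that the resulting invariants are twice those of another Seifert group.  All
  identities between the maps involved are checked on generators.\<close>

lemma seifert_kernel_iso:
  fixes e e' \<epsilon> g n a b b' d p
  defines "L \<equiv> seifert_group e \<epsilon> g n a b" and "y \<equiv> seifert_elem e \<epsilon> g n a b"
  assumes e: "e = 2 * e' + (\<Sum>k = 1..n. d k) + 2 * (\<Sum>j = 1..num_v \<epsilon> g. surface_coeff \<epsilon> j * p j)"
    and b: "\<And>k. k \<in> {1..n} \<Longrightarrow> b k = 2 * b' k - d k * a k"
    and \<phi>: "\<phi> \<in> hom L (integer_mod_group 2)" and \<phi>h: "\<phi> (y Hgen) = 1"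
    and \<phi>s: "\<And>k. k \<in> {1..n} \<Longrightarrow> [\<phi> (y (Sgen k)) = d k] (mod 2)"
    and \<phi>v: "\<And>j. j \<in> {1..num_v \<epsilon> g} \<Longrightarrow> [\<phi> (y (Vgen j)) = p j] (mod 2)"
  shows "L\<lparr>carrier := kernel L (integer_mod_group 2) \<phi>\<rparr> \<cong> seifert_group e' \<epsilon> g n a b'"
proof -
  define A where "A = seifert_group e' \<epsilon> g n a b'"
  define x where "x = seifert_elem e' \<epsilon> g n a b'"
  note hom_eqI_A = seifert_group_hom_eqI [where e = e' and \<epsilon> = \<epsilon> and g = g and n = n and a = a and b = b',
      folded A_def x_def]
  note hom_eqI_L = seifert_group_hom_eqI [where e = e and \<epsilon> = \<epsilon> and g = g and n = n and a = a and b = b,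
      folded L_def y_def]
  interpret L: group L unfolding L_def by (rule seifert_group_is_group)
  obtain \<alpha> where sq: "square_root_data A \<alpha> (x Hgen)"
    and \<alpha>x: "\<And>w. w \<in> seifert_gens \<epsilon> g n \<Longrightarrow> \<alpha> (x w) = shift_fibre A (\<lambda>k. 0) (flip \<epsilon>) x w"
    by (rule fibre_root_automorphism [of e' \<epsilon> g n a b', folded A_def x_def], rule that)
  interpret square_root_data A \<alpha> "x Hgen" by (fact sq)
  interpret E: group E by (rule group_root_extension)
  let ?X = "seifert_gens \<epsilon> g n"
  have H: "Hgen \<in> ?X" by (simp add: seifert_gens_mem)
  let ?d' = "\<lambda>k. - d k" and ?p' = "\<lambda>j. - p j"

  have tupA: "seifert_tuple A e' \<epsilon> g n a b' x" unfolding A_def x_def by (rule seifert_tuple_elem)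
  then have frA: "fibre_relations A \<epsilon> g n x" by (simp only: seifert_tuple_iff [OF is_group])
  note xD = fibre_relationsD [OF frA]
  have tupL: "seifert_tuple L e \<epsilon> g n a b y" unfolding L_def y_def by (rule seifert_tuple_elem)
  then have frL: "fibre_relations L \<epsilon> g n y" by (simp only: seifert_tuple_iff [OF L.is_group])
  note yD = L.fibre_relationsD [OF frL]

  \<comment> \<open>The shifted generators of \<open>L\<close>: they lie in the kernel, except for the fibre, whose square does.\<close>
  define y' where "y' = shift_fibre L d p y"
  have y'H: "y' Hgen = y Hgen" by (simp add: y'_def)
  have frL': "fibre_relations L \<epsilon> g n y'" unfolding y'_def by (rule L.fibre_relations_shift [OF frL])
  note y'D = L.fibre_relationsD [OF frL']
  have "seifert_tuple L (2 * e') \<epsilon> g n a (\<lambda>k. 2 * b' k) y'"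
    unfolding y'_def by (rule L.seifert_tuple_shift [OF tupL]) (simp_all add: e b)
  then have halved: "seifert_tuple L e' \<epsilon> g n a b' (y'(Hgen := y' Hgen [^]\<^bsub>L\<^esub> (2::int)))"
    by (simp only: L.seifert_tuple_square_fibre [OF frL'])
  obtain \<psi> where \<psi>: "\<psi> \<in> hom A L"
    and \<psi>x: "\<And>w. w \<in> ?X \<Longrightarrow> \<psi> (x w) = (y'(Hgen := y' Hgen [^]\<^bsub>L\<^esub> (2::int))) w"
    by (rule seifert_tuple_extends [OF L.is_group halved, folded A_def x_def], rule that)
  have hh: "y Hgen \<otimes>\<^bsub>L\<^esub> y Hgen = \<psi> (x Hgen)"
    using L.int_pow_mult [OF yD(2), of 1 1] yD(2) \<psi>x [OF H] by (simp add: y'H)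

  \<comment> \<open>In \<open>E\<close> the fibre of \<open>A\<close> is replaced by its root.  The assignment \<open>u\<close> is the counterpart of \<open>y'\<close>.\<close>
  define u where "u w = (if w = Hgen then (\<one>\<^bsub>A\<^esub>, True) else (x w, False))" for w
  have u_simps: "u Hgen = (\<one>\<^bsub>A\<^esub>, True)" "u (Sgen k) = (x (Sgen k), False)"
    "u (Vgen j) = (x (Vgen j), False)" for k j by (simp_all add: u_def)
  have frE: "fibre_relations E \<epsilon> g n u"
    unfolding fibre_relations_def
  proof (intro conjI ballI)
    show "u ` ?X \<subseteq> carrier E" using xD(3,4) by (auto simp: seifert_gens_def u_simps)
    fix k assume k: "k \<in> {1..n}"
    have "\<alpha> (x (Sgen k)) = x (Sgen k)"
      using \<alpha>x [of "Sgen k"] k xD(3) [OF k] by (simp add: seifert_gens_mem)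
    then show "u (Sgen k) \<otimes>\<^bsub>E\<^esub> u Hgen = u Hgen \<otimes>\<^bsub>E\<^esub> u (Sgen k)"
      using xD(3) [OF k] by (simp add: u_simps alpha_one)
  next
    fix j assume j: "j \<in> {1..num_v \<epsilon> g}"
    have V: "x (Vgen j) \<in> carrier A" by (rule xD(4) [OF j])
    have \<alpha>V: "\<alpha> (x (Vgen j)) = x (Vgen j) \<otimes>\<^bsub>A\<^esub> x Hgen [^]\<^bsub>A\<^esub> (- flip \<epsilon> j)"
      using \<alpha>x [of "Vgen j"] j by (simp add: seifert_gens_mem)
    have uc: "u Hgen \<in> carrier E" "u (Vgen j) \<in> carrier E" using V by (simp_all add: u_simps)
    show "u (Vgen j) \<otimes>\<^bsub>E\<^esub> u Hgen = u Hgen [^]\<^bsub>E\<^esub> seifert_sign \<epsilon> j \<otimes>\<^bsub>E\<^esub> u (Vgen j)"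
    proof (cases "seifert_sign \<epsilon> j = 1")
      case True
      then show ?thesis using V \<alpha>V by (simp add: E.int_pow_1 [OF uc(1)]) (simp add: u_simps alpha_one flip_def)
    next
      case False
      then have s: "seifert_sign \<epsilon> j = - 1" using seifert_sign_cases by blast
      have "u Hgen \<otimes>\<^bsub>E\<^esub> (u (Vgen j) \<otimes>\<^bsub>E\<^esub> u Hgen) = u (Vgen j)"
        using V False \<alpha>V by (simp add: u_simps alpha_one alpha_mult flip_def int_pow_neg m_assoc)
      then show ?thesis
        unfolding s E.int_pow_neg [OF uc(1)] E.int_pow_1 [OF uc(1)]
        by (rule iffD2 [OF E.inv_solve_left [OF E.m_closed [OF uc(2) uc(1)] uc(1) uc(2)] HOL.sym])
    qed
  qed
  have emb: "u w = (x w, False)" if "w \<noteq> Hgen" for w using that by (simp add: u_def)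
  have root: "(u(Hgen := u Hgen [^]\<^bsub>E\<^esub> (2::int))) w = (x w, False)" for w
    by (simp add: u_simps root_square emb)
  have "seifert_tuple E e' \<epsilon> g n a b' ((\<lambda>w. (w, False)) \<circ> x)"
    by (rule seifert_tuple_hom [OF is_group E.is_group embedding_hom tupA])
  then have "seifert_tuple E e' \<epsilon> g n a b' (u(Hgen := u Hgen [^]\<^bsub>E\<^esub> (2::int)))"
    by (subst seifert_tuple_cong [where f' = "(\<lambda>w. (w, False)) \<circ> x"]) (simp_all add: root del: fun_upd_apply)
  then have tupE: "seifert_tuple E (2 * e') \<epsilon> g n a (\<lambda>k. 2 * b' k) u"
    by (simp only: E.seifert_tuple_square_fibre [OF frE])
  \<comment> \<open>Undoing the shift in \<open>E\<close> gives the counterpart of the original generators of \<open>L\<close>.\<close>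
  define u' where "u' = shift_fibre E ?d' ?p' u"
  have tupE': "seifert_tuple E e \<epsilon> g n a b u'"
    unfolding u'_def by (rule E.seifert_tuple_shift [OF tupE]) (simp_all add: e b sum_negf)
  obtain \<Phi> where \<Phi>: "\<Phi> \<in> hom L E" and \<Phi>y: "\<And>w. w \<in> ?X \<Longrightarrow> \<Phi> (y w) = u' w"
    by (rule seifert_tuple_extends [OF E.is_group tupE', folded L_def y_def], rule that)

  have \<Phi>y': "\<Phi> (y' w) = u w" if w: "w \<in> ?X" for w
  proof -
    have "\<Phi> (y' w) = shift_fibre E d p (\<Phi> \<circ> y) w"
      unfolding y'_def by (rule shift_fibre_hom [OF L.is_group E.is_group \<Phi> yD(1) w])
    also have "\<dots> = shift_fibre E d p u' w"
      by (rule shift_fibre_cong [OF _ w]) (simp add: \<Phi>y)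
    also have "\<dots> = u w"
      using E.shift_fibre_inverse [OF frE w, of ?d' ?p'] by (simp add: u'_def)
    finally show ?thesis .
  qed
  have \<Phi>\<psi>: "\<Phi> (\<psi> w) = (w, False)" if "w \<in> carrier A" for w
  proof -
    have "(\<Phi> \<circ> \<psi>) w = (w, False)"
    proof (rule hom_eqI_A [where p = "\<Phi> \<circ> \<psi>" and q = "\<lambda>w. (w, False)",
          OF E.is_group])
      fix w assume w: "w \<in> ?X"
      show "(\<Phi> \<circ> \<psi>) (x w) = (x w, False)"
      proof (cases "w = Hgen")
        case True
        have "\<Phi> (y' Hgen [^]\<^bsub>L\<^esub> (2::int)) = (x Hgen, False)"
          using hom_int_pow [OF \<Phi> y'D(2) L.is_group E.is_group] \<Phi>y' [OF H] by (simp add: u_simps root_square)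
        then show ?thesis using True \<psi>x [OF H] by simp
      next
        case False
        then show ?thesis using w by (simp add: \<psi>x \<Phi>y' emb)
      qed
    qed (use that embedding_hom Group.hom_compose [OF \<psi> \<Phi>] E.is_group in simp_all)
    then show ?thesis by simp
  qed

  have h\<psi>: "y Hgen \<otimes>\<^bsub>L\<^esub> \<psi> w = \<psi> (\<alpha> w) \<otimes>\<^bsub>L\<^esub> y Hgen" if w: "w \<in> carrier A" for w
  proof -
    have conj_hom: "(\<lambda>w. y Hgen \<otimes>\<^bsub>L\<^esub> w \<otimes>\<^bsub>L\<^esub> inv\<^bsub>L\<^esub> y Hgen) \<in> hom L L"
      using yD(2) by (intro homI) (auto simp: L.m_assoc L.inv_solve_left)
    have "(\<psi> \<circ> \<alpha>) w = ((\<lambda>w. y Hgen \<otimes>\<^bsub>L\<^esub> w \<otimes>\<^bsub>L\<^esub> inv\<^bsub>L\<^esub> y Hgen) \<circ> \<psi>) w"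
    proof (rule hom_eqI_A [where p = "\<psi> \<circ> \<alpha>" and
          q = "(\<lambda>w. y Hgen \<otimes>\<^bsub>L\<^esub> w \<otimes>\<^bsub>L\<^esub> inv\<^bsub>L\<^esub> y Hgen) \<circ> \<psi>",
          OF L.is_group])
      fix w assume w: "w \<in> ?X"
      have yw: "y' w \<in> carrier L" using y'D(1) w by (auto simp: image_subset_iff)
      have "\<psi> (\<alpha> (x w)) = shift_fibre L (\<lambda>k. 0) (flip \<epsilon>) (\<psi> \<circ> x) w"
        unfolding \<alpha>x [OF w] by (rule shift_fibre_hom [OF is_group L.is_group \<psi> xD(1) w])
      also have "\<dots> = shift_fibre L (\<lambda>k. 0) (flip \<epsilon>) (y'(Hgen := y' Hgen [^]\<^bsub>L\<^esub> (2::int))) w"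
        by (rule shift_fibre_cong [OF _ w]) (simp only: comp_apply \<psi>x)
      finally have \<psi>\<alpha>: "\<psi> (\<alpha> (x w)) =
          shift_fibre L (\<lambda>k. 0) (flip \<epsilon>) (y'(Hgen := y' Hgen [^]\<^bsub>L\<^esub> (2::int))) w" .
      have "y Hgen \<otimes>\<^bsub>L\<^esub> \<psi> (x w) = \<psi> (\<alpha> (x w)) \<otimes>\<^bsub>L\<^esub> y Hgen"
      proof (cases "w = Hgen")
        case True
        have "y Hgen \<otimes>\<^bsub>L\<^esub> y Hgen [^]\<^bsub>L\<^esub> (2::int) = y Hgen [^]\<^bsub>L\<^esub> (2::int) \<otimes>\<^bsub>L\<^esub> y Hgen"
          using L.int_pow_mult [OF yD(2), of 1 2] L.int_pow_mult [OF yD(2), of 2 1] yD(2) by simp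
        then show ?thesis unfolding \<psi>\<alpha> \<psi>x [OF w] by (simp add: True y'H)
      next
        case False
        then have "\<psi> (\<alpha> (x w)) = shift_fibre L (\<lambda>k. 0) (\<lambda>j. 2 * flip \<epsilon> j) y' w"
          unfolding \<psi>\<alpha> using y'D(2) by (cases w) (simp_all add: L.int_pow_pow)
        then show ?thesis
          using L.conjugation_by_fibre [OF frL' w] False w by (simp add: y'H \<psi>x)
      qed
      then show "(\<psi> \<circ> \<alpha>) (x w) = ((\<lambda>w. y Hgen \<otimes>\<^bsub>L\<^esub> w \<otimes>\<^bsub>L\<^esub> inv\<^bsub>L\<^esub> y Hgen) \<circ> \<psi>) (x w)"
        using yD(2) xD(1) w hom_in_carrier [OF \<psi>] alpha_closed
        by (simp add: L.m_assoc image_subset_iff)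
    qed (use w Group.hom_compose [OF \<psi> conj_hom] Group.hom_compose [OF alpha_hom \<psi>] L.is_group in simp_all)
    then show ?thesis
      using w yD(2) hom_in_carrier [OF \<psi>] by (simp add: L.m_assoc)
  qed

  \<comment> \<open>The extension of \<open>\<psi>\<close> to \<open>E\<close>, inverse to \<open>\<Phi>\<close>.\<close>
  define \<Psi> where "\<Psi> = (\<lambda>(w, i). \<psi> w \<otimes>\<^bsub>L\<^esub> (if i then y Hgen else \<one>\<^bsub>L\<^esub>))"
  have \<Psi>: "\<Psi> \<in> hom E L"
    unfolding \<Psi>_def by (rule root_extension_hom [OF L.is_group \<psi> yD(2) hh h\<psi>])
  have \<Psi>u: "\<Psi> (u w) = y' w" if w: "w \<in> ?X" for w
  proof (cases "w = Hgen")
    case True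
    then show ?thesis using yD(2) hom_one [OF \<psi> is_group L.is_group] by (simp add: \<Psi>_def u_simps y'H)
  next
    case False
    then show ?thesis using w y'D(1) by (simp add: \<Psi>_def emb \<psi>x image_subset_iff)
  qed
  have \<Psi>\<Phi>: "\<Psi> (\<Phi> w) = w" if "w \<in> carrier L" for w
  proof -
    have "(\<Psi> \<circ> \<Phi>) w = id w"
    proof (rule hom_eqI_L [where p = "\<Psi> \<circ> \<Phi>" and q = id,
          OF L.is_group])
      fix w assume w: "w \<in> ?X"
      have "\<Psi> (\<Phi> (y w)) = shift_fibre L ?d' ?p' (\<Psi> \<circ> u) w"
        unfolding \<Phi>y [OF w] u'_def
        by (rule shift_fibre_hom [OF E.is_group L.is_group \<Psi> E.fibre_relationsD(1) [OF frE] w])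
      also have "\<dots> = shift_fibre L ?d' ?p' y' w"
        by (rule shift_fibre_cong [OF _ w]) (simp add: \<Psi>u)
      also have "\<dots> = y w"
        unfolding y'_def by (rule L.shift_fibre_inverse [OF frL w])
      finally show "(\<Psi> \<circ> \<Phi>) (y w) = id (y w)" by simp
    qed (use that Group.hom_compose [OF \<Phi> \<Psi>] L.is_group in \<open>simp_all add: hom_def\<close>)
    then show ?thesis by simp
  qed

  have \<phi>\<psi>: "\<phi> (\<psi> w) = 0" if "w \<in> carrier A" for w
  proof -
    have "(\<phi> \<circ> \<psi>) w = (\<lambda>w. 0) w"
    proof (rule hom_eqI_A [where p = "\<phi> \<circ> \<psi>" and q = "\<lambda>w. 0",
          OF group_integer_mod_group [of 2]])
      fix w assume w: "w \<in> ?X"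
      note \<phi>m = hom_mult [OF \<phi>] and \<phi>p = hom_int_pow [OF \<phi> yD(2) L.is_group group_integer_mod_group]
      show "(\<phi> \<circ> \<psi>) (x w) = 0"
      proof (cases w)
        case (Sgen k)
        then have k: "k \<in> {1..n}" using w by (simp add: seifert_gens_mem)
        show ?thesis
          using \<phi>s [OF k] w Sgen yD(2) yD(3) [OF k]
          by (simp add: \<psi>x y'_def \<phi>m \<phi>p \<phi>h int_pow_integer_mod_group cong_iff_dvd_diff mod_simps dvd_eq_mod_eq_0)
      next
        case (Vgen j)
        then have j: "j \<in> {1..num_v \<epsilon> g}" using w by (simp add: seifert_gens_mem)
        show ?thesis
          using \<phi>v [OF j] w Vgen yD(2) yD(4) [OF j]
          by (simp add: \<psi>x y'_def \<phi>m \<phi>p \<phi>h int_pow_integer_mod_group cong_iff_dvd_diff mod_simps dvd_eq_mod_eq_0)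
      next
        case Hgen
        then show ?thesis
          using w by (simp add: \<psi>x y'H \<phi>p \<phi>h int_pow_integer_mod_group)
      qed
    qed (use that Group.hom_compose [OF \<psi> \<phi>] in \<open>simp_all add: hom_def\<close>)
    then show ?thesis by simp
  qed
  have "\<psi> \<in> iso A (L\<lparr>carrier := kernel L (integer_mod_group 2) \<phi>\<rparr>)"
    by (rule kernel_iso [OF L.is_group \<psi> yD(2) \<Phi> \<Phi>\<psi> _ \<phi> \<phi>h \<phi>\<psi>])
      (use \<Psi>\<Phi> in \<open>simp_all add: \<Psi>_def\<close>)
  then have "A \<cong> L\<lparr>carrier := kernel L (integer_mod_group 2) \<phi>\<rparr>" by (rule is_isoI)
  then show ?thesis
    unfolding A_def [symmetric] by (rule iso_sym)
qed

section \<open>Arithmetic of the invariants\<close>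

text \<open>The relations of a Seifert group in \<open>\<int>\<^sub>2\<close>, with the fibre sent to \<open>1\<close>.  If \<open>b k\<close> is odd, the relation
  for \<open>s k\<close> forces both \<open>a k\<close> and the value of \<open>s k\<close> to be odd; if \<open>b k\<close> is even then \<open>a k\<close> is
  odd by coprimality and the value of \<open>s k\<close> is \<open>0\<close>.  For the parity of \<open>e\<close>, shift all letters by their own
  values: they become trivial, and the long relator reduces to a power of the fibre.\<close>

lemma mod_two_seifert_tuple:
  assumes q: "seifert_tuple (integer_mod_group 2) e \<epsilon> g n a b q" and h: "q Hgen = 1"
    and cop: "\<And>k. k \<in> {1..n} \<Longrightarrow> coprime (a k) (b k)"
  shows "k \<in> {1..n} \<Longrightarrow> q (Sgen k) = (if odd (b k) then 1 else 0)"
    and "k \<in> {1..n} \<Longrightarrow> odd (b k) \<Longrightarrow> odd (a k)"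
    and "even (e - (\<Sum>k = 1..n. q (Sgen k)))"
proof -
  let ?Z = "integer_mod_group 2"
  interpret Z: group ?Z by simp
  note tuple = q [unfolded seifert_tuple_iff [OF Z.is_group]]
  have fr: "fibre_relations ?Z \<epsilon> g n q" using tuple by (rule conjunct1)
  note qD = Z.fibre_relationsD [OF fr]
  have range: "q (Sgen k) = 0 \<or> q (Sgen k) = 1" if "k \<in> {1..n}" for k
    using qD(3) [OF that] by (auto simp: carrier_integer_mod_group)
  have rel: "even (a k * q (Sgen k) + b k)" if "k \<in> {1..n}" for k
  proof -
    have "(a k * q (Sgen k) mod 2 + b k * q Hgen mod 2) mod 2 = 0"
      using conjunct1 [OF conjunct2 [OF tuple]] that
      by (simp only: int_pow_integer_mod_group mult_integer_mod_group one_integer_mod_group) simp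
    then show ?thesis by (simp add: h mod_simps dvd_eq_mod_eq_0)
  qed
  have no_two: "\<not> (even (a k) \<and> even (b k))" if "k \<in> {1..n}" for k
    using cop [OF that] coprime_common_divisor [of "a k" "b k" 2] by auto
  show "q (Sgen k) = (if odd (b k) then 1 else 0)" if "k \<in> {1..n}"
    using range [OF that] rel [OF that] no_two [OF that] by auto
  show "odd (a k)" if "k \<in> {1..n}" "odd (b k)"
    using range [OF that(1)] rel [OF that(1)] that(2) by auto
  define d where "d k = q (Sgen k)" for k
  define p where "p j = q (Vgen j)" for j
  define e' where "e' = e - (\<Sum>k = 1..n. d k) - 2 * (\<Sum>j = 1..num_v \<epsilon> g. surface_coeff \<epsilon> j * p j)"
  let ?q = "shift_fibre ?Z d p q"
  have "seifert_tuple ?Z e' \<epsilon> g n a (\<lambda>k. b k + d k * a k) ?q"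
    by (rule Z.seifert_tuple_shift [OF q e'_def HOL.refl])
  note tuple' = this [unfolded seifert_tuple_iff [OF Z.is_group]]
  \<comment> \<open>Each letter is multiplied by \<open>h\<close> to minus its own value, and \<open>h\<close> is the generator \<open>1\<close> of \<open>\<int>\<^sub>2\<close>.\<close>
  have trivial: "?q x = \<one>\<^bsub>?Z\<^esub>" if "x \<in> Sgen ` {1..n} \<union> Vgen ` {1..num_v \<epsilon> g}" for x
    using that qD(3,4) by (auto simp: d_def p_def h int_pow_integer_mod_group mod_simps)
  have S: "word_eval ?Z ?q (exceptional_word n) = \<one>\<^bsub>?Z\<^esub>"
    by (rule word_eval_trivial [OF Z.is_group exceptional_word_in_words]) (rule trivial, simp)
  have V: "word_eval ?Z ?q (surface_word \<epsilon> g) = \<one>\<^bsub>?Z\<^esub>"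
    by (rule word_eval_trivial [OF Z.is_group surface_word_in_words]) (rule trivial, simp)
  have "- e' mod 2 = 0"
    using conjunct2 [OF conjunct2 [OF tuple']] unfolding S V by (simp add: h int_pow_integer_mod_group)
  then have "even e'" by presburger
  then show "even (e - (\<Sum>k = 1..n. q (Sgen k)))"
    by (simp add: e'_def d_def)
qed

text \<open>The case distinction in the hypothesis is a uniform condition in disguise: modulo 2, the coefficients
  of the surface word are all \<open>0\<close> for \<open>O1\<close> and \<open>N2\<close>, all \<open>1\<close> for \<open>O2\<close> and \<open>N1\<close>, and \<open>1\<close> just
  for the letters with sign \<open>1\<close> for \<open>N3\<close> and \<open>N4\<close>.  The lower bound on the genus guarantees that these
  letters exist.\<close>

lemma surface_sum_parity:
  fixes q :: "nat \<Rightarrow> int"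
  assumes g: "min_genus \<epsilon> \<le> g"
    and m': "case \<epsilon> of
               O1 \<Rightarrow> m' = 0
             | N2 \<Rightarrow> m' = 0
             | O2 \<Rightarrow> [m' = (\<Sum>j = 1..num_v \<epsilon> g. q j)] (mod 2)
             | N1 \<Rightarrow> [m' = (\<Sum>j = 1..num_v \<epsilon> g. q j)] (mod 2)
             | N3 \<Rightarrow> [m' = q 1] (mod 2)
             | N4 \<Rightarrow> [m' = q 1 + q 2] (mod 2)"
  shows "[m' = (\<Sum>j = 1..num_v \<epsilon> g. surface_coeff \<epsilon> j * q j)] (mod 2)"
proof (cases \<epsilon>)
  case O1
  then show ?thesis using m' by (simp add: surface_coeff_def)
next
  case O2
  have "[(\<Sum>j = 1..num_v \<epsilon> g. q j) = (\<Sum>j = 1..num_v \<epsilon> g. surface_coeff \<epsilon> j * q j)] (mod 2)"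
    by (rule cong_sum) (auto simp: O2 surface_coeff_def cong_iff_dvd_diff)
  then show ?thesis using m' O2 by (auto intro: cong_trans)
next
  case N1
  then show ?thesis using m' by (simp add: surface_coeff_def)
next
  case N2
  then show ?thesis using m' by (simp add: surface_coeff_def)
next
  case N3
  have "(\<Sum>j = 1..num_v \<epsilon> g. surface_coeff \<epsilon> j * q j) = (\<Sum>j\<in>{1}. surface_coeff \<epsilon> j * q j)"
    using g N3 by (intro sum.mono_neutral_right) (auto simp: surface_coeff_def num_v_def)
  then show ?thesis using m' N3 by (simp add: surface_coeff_def)
next
  case N4
  have "(\<Sum>j = 1..num_v \<epsilon> g. surface_coeff \<epsilon> j * q j) = (\<Sum>j\<in>{1, 2}. surface_coeff \<epsilon> j * q j)"
    using g N4 by (intro sum.mono_neutral_right) (auto simp: surface_coeff_def num_v_def)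
  then show ?thesis using m' N4 by (simp add: surface_coeff_def)
qed

text \<open>The defect \<open>r\<close> of the lift \<open>q\<close> is even, so it can be absorbed in the first letter without changing
  a parity; the coefficient of that letter is its own inverse unless all coefficients vanish.\<close>

lemma surface_lift_exists:
  fixes q :: "nat \<Rightarrow> int"
  assumes g: "min_genus \<epsilon> \<le> g"
    and m': "[m' = (\<Sum>j = 1..num_v \<epsilon> g. surface_coeff \<epsilon> j * q j)] (mod 2)"
    and zero: "\<epsilon> \<in> {O1, N2} \<Longrightarrow> m' = 0"
  obtains p where "\<And>j. [q j = p j] (mod 2)"
    "(\<Sum>j = 1..num_v \<epsilon> g. surface_coeff \<epsilon> j * p j) = m'"
proof (cases "\<epsilon> \<in> {O1, N2}")
  case True
  show thesis
    by (rule that [of q]) (use True zero in \<open>auto simp: surface_coeff_def\<close>)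
next
  case False
  define r where "r = m' - (\<Sum>j = 1..num_v \<epsilon> g. surface_coeff \<epsilon> j * q j)"
  define c where "c = surface_coeff \<epsilon> 1"
  have r: "even r" using m' by (simp add: r_def cong_iff_dvd_diff)
  have one: "1 \<in> {1..num_v \<epsilon> g}" and c: "c * c = 1"
    using g False by (cases \<epsilon>; auto simp: num_v_def surface_coeff_def c_def)+
  define p where "p j = q j + (if j = 1 then c * r else 0)" for j
  have "(\<Sum>j = 1..num_v \<epsilon> g. surface_coeff \<epsilon> j * p j) =
      (\<Sum>j = 1..num_v \<epsilon> g. surface_coeff \<epsilon> j * q j + (if j = 1 then c * (c * r) else 0))"
    by (intro sum.cong HOL.refl) (simp add: p_def c_def distrib_left)
  also have "\<dots> = (\<Sum>j = 1..num_v \<epsilon> g. surface_coeff \<epsilon> j * q j) + c * (c * r)"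
    using one by (simp add: sum.distrib)
  also have "\<dots> = m'"
    using c by (simp add: r_def mult.assoc [symmetric])
  finally have "(\<Sum>j = 1..num_v \<epsilon> g. surface_coeff \<epsilon> j * p j) = m'" .
  moreover have "[q j = p j] (mod 2)" for j
    using r by (simp add: p_def cong_iff_dvd_diff)
  ultimately show thesis using that by blast
qed

text \<open>A common divisor of \<open>a k\<close> and \<open>b' k\<close> divides \<open>2 * b' k\<close>, which is \<open>b k\<close> or \<open>a k + b k\<close>, both
  coprime to \<open>a k\<close>.\<close>

lemma seifert_invariants_half:
  assumes inv: "seifert_invariants \<epsilon> g n a b"
    and odd_a: "\<And>k. k \<in> {1..n} \<Longrightarrow> odd (b k) \<Longrightarrow> odd (a k)"
    and b': "\<And>k. k \<in> {1..n} \<Longrightarrow> b' k = (if even (b k) then b k div 2 else (a k + b k) div 2)"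
  shows "seifert_invariants \<epsilon> g n a b'"
proof -
  have "coprime (a k) (b' k)" if k: "k \<in> {1..n}" for k
  proof -
    have ab: "coprime (a k) (b k)" using inv k by (simp add: seifert_invariants_def)
    then have ab': "coprime (a k) (a k + b k)" by (simp add: coprime_iff_gcd_eq_1)
    show ?thesis
    proof (cases "even (b k)")
      case True
      then have "b' k dvd b k" using b' [OF k] by (metis dvd_div_mult_self dvd_triv_left)
      then show ?thesis using ab by (meson coprime_divisors dvd_refl)
    next
      case False
      then have "even (a k + b k)" using odd_a [OF k] by simp
      then have "b' k dvd a k + b k" using False b' [OF k] by (metis dvd_div_mult_self dvd_triv_left)
      then show ?thesis using ab' by (meson coprime_divisors dvd_refl)
    qed
  qed
  then show ?thesis using inv by (simp add: seifert_invariants_def)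
qed

theorem theorem1:
  fixes e m' :: int and \<epsilon> :: seifert_type and g n m :: nat
    and a b b' :: "nat \<Rightarrow> int"
    and G :: "seifert_gen word set monoid"
    and \<phi> :: "seifert_gen word set \<Rightarrow> int"
    and h :: "seifert_gen word set"
    and v :: "nat \<Rightarrow> seifert_gen word set"
  assumes inv: "seifert_invariants \<epsilon> g n a b"
    and G: "G = seifert_group e \<epsilon> g n a b"
    and h: "h = seifert_elem e \<epsilon> g n a b Hgen"
    and v: "\<And>j. v j = seifert_elem e \<epsilon> g n a b (Vgen j)"
    and epi: "\<phi> \<in> epi G (integer_mod_group 2)"
    and phi_h: "\<phi> h = 1"
    and b': "\<And>k. k \<in> {1..n} \<Longrightarrow> b' k = (if even (b k) then b k div 2 else (a k + b k) div 2)"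
    and m: "m = card {k \<in> {1..n}. odd (b k)}"
    and m': "case \<epsilon> of
               O1 \<Rightarrow> m' = 0
             | N2 \<Rightarrow> m' = 0
             | O2 \<Rightarrow> [m' = (\<Sum>j = 1..num_v \<epsilon> g. \<phi> (v j))] (mod 2)
             | N1 \<Rightarrow> [m' = (\<Sum>j = 1..num_v \<epsilon> g. \<phi> (v j))] (mod 2)
             | N3 \<Rightarrow> [m' = \<phi> (v 1)] (mod 2)
             | N4 \<Rightarrow> [m' = \<phi> (v 1) + \<phi> (v 2)] (mod 2)"
  shows "even (e - int m) \<and>
         (\<forall>k\<in>{1..n}. odd (b k) \<longrightarrow> even (a k + b k)) \<and>
         seifert_invariants \<epsilon> g n a b' \<and>
         G\<lparr>carrier := kernel G (integer_mod_group 2) \<phi>\<rparr> \<cong>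
           seifert_group ((e - int m) div 2 - m') \<epsilon> g n a b'"
proof -
  let ?y = "seifert_elem e \<epsilon> g n a b"
  have \<phi>: "\<phi> \<in> hom G (integer_mod_group 2)" using epi by (simp add: epi_def)
  have grp: "group G" unfolding G by (rule seifert_group_is_group)
  have genus: "min_genus \<epsilon> \<le> g" and cop: "\<And>k. k \<in> {1..n} \<Longrightarrow> coprime (a k) (b k)"
    using inv by (auto simp: seifert_invariants_def)
  have tuple: "seifert_tuple (integer_mod_group 2) e \<epsilon> g n a b (\<phi> \<circ> ?y)"
    using seifert_tuple_hom [OF grp _ \<phi>] seifert_tuple_elem unfolding G by simp
  have fibre: "(\<phi> \<circ> ?y) Hgen = 1" using phi_h h by simp
  note parity = mod_two_seifert_tuple [OF tuple fibre cop]
  define d where "d k = (if odd (b k) then 1 else 0 :: int)" for k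
  have "(\<Sum>k = 1..n. (\<phi> \<circ> ?y) (Sgen k)) = (\<Sum>k = 1..n. d k)"
    by (intro sum.cong HOL.refl) (simp only: parity(1) d_def)
  moreover have "(\<Sum>k = 1..n. d k) = int m"
    by (simp add: d_def m sum.If_cases Int_def)
  ultimately have dm: "(\<Sum>k = 1..n. (\<phi> \<circ> ?y) (Sgen k)) = int m" "(\<Sum>k = 1..n. d k) = int m"
    by (simp_all only:)
  have em: "even (e - int m)" using parity(3) unfolding dm .
  have odd_a: "odd (a k)" if "k \<in> {1..n}" "odd (b k)" for k using parity(2) [OF _ that] by simp
  obtain p where p: "\<And>j. [\<phi> (v j) = p j] (mod 2)"
    and pm: "(\<Sum>j = 1..num_v \<epsilon> g. surface_coeff \<epsilon> j * p j) = m'"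
    by (rule surface_lift_exists [OF genus surface_sum_parity [OF genus m']])
      (use m' in auto)
  have "G\<lparr>carrier := kernel G (integer_mod_group 2) \<phi>\<rparr> \<cong>
      seifert_group ((e - int m) div 2 - m') \<epsilon> g n a b'"
    unfolding G
  proof (rule seifert_kernel_iso)
    show "e = 2 * ((e - int m) div 2 - m') + (\<Sum>k = 1..n. d k) +
        2 * (\<Sum>j = 1..num_v \<epsilon> g. surface_coeff \<epsilon> j * p j)"
      unfolding dm(2) pm using em by (simp add: right_diff_distrib)
    show "b k = 2 * b' k - d k * a k" if "k \<in> {1..n}" for k
      using b' [OF that] odd_a [OF that] by (simp add: d_def)
    show "\<phi> \<in> hom (seifert_group e \<epsilon> g n a b) (integer_mod_group 2)" using \<phi> unfolding G .
    show "\<phi> (?y Hgen) = 1" using fibre by simp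
    show "[\<phi> (?y (Sgen k)) = d k] (mod 2)" if "k \<in> {1..n}" for k
      using parity(1) [OF _ that] by (simp add: d_def)
    show "[\<phi> (?y (Vgen j)) = p j] (mod 2)" if "j \<in> {1..num_v \<epsilon> g}" for j
      using p [of j] by (simp add: v)
  qed
  then show ?thesis
    using em odd_a seifert_invariants_half [OF inv odd_a b'] by auto
qed

end
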